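(* Let $\beta<1$, let $A:\mathbb{R}^d\to\mathbb{R}^d$, and let $\xi:[0,\infty)\to\mathbb{R}^d$ be a locally bounded measurable function with $\xi(0)=0$. Assume that: (1) $A_{rad}(x)=a(x)r^\beta\varphi$, and for all $\varphi_0\in S^{d-1}$ the limit $\lim_{r\to+\infty,\ \varphi\to\varphi_0}a(x)=:\bar a(\varphi_0)$ exists, where $\bar a:S^{d-1}\to\mathbb{R}$ is a positive continuous function; (2) there exist $\gamma>0$, $C_{tan}>0$, $R_{tan}>0$ such that $\sup_{|y|=r}|A_{tan}(y)|\le C_{tan}r^{\beta-\gamma}$ for all $r>R_{tan}$; (3) there exist $\delta>0$ and $C_\xi>0$ such that $|\xi(t)|\le C_\xi\big(1+t^{\frac{1}{1-\beta}-\delta}\big)$ for all $t\ge0$. Then there is $R_0=R_0(A,\delta,\beta,C_\xi)>0$ such that for any $x\in\mathbb{R}^d$ with $|x|\ge R_0$ and any solution $Z(t)=Z_x(t)$, $Z_x(0)=x$, of $dZ(t)=A(Z(t))dt+d\xi(t)$, we have: (a) $\lim_{t\to\infty}|Z_x(t)|=+\infty$; (b) the limit $\varphi_{Z_x}(+\infty):=\lim_{t\to\infty}\frac{Z_x(t)}{|Z_x(t)|}$ exists; (c) $Z_x(t)\sim\big((1-\beta)\,\bar a(\varphi_{Z_x}(+\infty))\,t\big)^{\frac1{1-\beta}}\varphi_{Z_x}(+\infty)$ as $t\to\infty$.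
   Context: Notation: $r=|x|$, $\varphi=x/|x|\in S^{d-1}$ for $x\neq0$ (arbitrary direction if $x=0$). $A_{rad}(x)=\langle A(x),\varphi\rangle\varphi$ and $A_{tan}(x)=A(x)-\langle A(x),\varphi\rangle\varphi$ are the radial and tangential components, $A=A_{rad}+A_{tan}$. A solution of $dZ(t)=A(Z(t))dt+d\xi(t)$, $Z(0)=x$, is a function satisfying $Z(t)=x+\int_0^tA(Z(s))ds+\xi(t)$ for all $t\ge0$ (integrals are assumed well-defined); uniqueness of solutions is not assumed. For vector functions, $f(t)\sim g(t)$ as $t\to\infty$ means $|f(t)-g(t)|=o(|g(t)|)$.
   Formalization: R_0 depends only on A, δ, β, C_ξ when δ ≤ 1/(1-β); for δ > 1/(1-β), where (3) does not control ξ near t=0 and such a uniform R_0 can fail to exist, R_0 may also depend on ξ. *)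

theory Defs
  imports "HOL-Analysis.Analysis" "HOL-Library.Landau_Symbols"
begin

text \<open>The direction \<open>\<phi> = x / |x|\<close> is \<^term>\<open>sgn x\<close>.  Since \<open>sgn 0 = 0\<close>, the two components below
  carry no meaning at the origin; they are only ever used at points \<open>x \<noteq> 0\<close>.\<close>

definition radial_part :: "('a \<Rightarrow> 'a) \<Rightarrow> 'a \<Rightarrow> 'a::real_inner" where
  "radial_part A x = (A x \<bullet> sgn x) *\<^sub>R sgn x"

definition tangential_part :: "('a \<Rightarrow> 'a) \<Rightarrow> 'a \<Rightarrow> 'a::real_inner" where
  "tangential_part A x = A x - radial_part A x"

text \<open>The limit as \<open>|x| \<rightarrow> \<infinity>\<close> and \<open>x / |x| \<rightarrow> \<phi>\<^sub>0\<close> is joint, and directions equal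
  to \<open>\<phi>\<^sub>0\<close> are not excluded.\<close>

definition radial_growth ::
  "real \<Rightarrow> ('a \<Rightarrow> real) \<Rightarrow> ('a \<Rightarrow> real) \<Rightarrow> ('a \<Rightarrow> 'a::real_inner) \<Rightarrow> bool" where
  "radial_growth \<beta> a abar A \<longleftrightarrow>
     (\<forall>x. x \<noteq> 0 \<longrightarrow> radial_part A x = (a x * norm x powr \<beta>) *\<^sub>R sgn x) \<and>
     (\<forall>\<phi>0 \<in> sphere 0 1.
        (a \<longlongrightarrow> abar \<phi>0) (inf at_infinity (filtercomap sgn (nhds \<phi>0)))) \<and>
     (\<forall>\<phi>0 \<in> sphere 0 1. abar \<phi>0 > 0) \<and>
     continuous_on (sphere 0 1) abar"

definition tangential_bound :: "real \<Rightarrow> ('a \<Rightarrow> 'a::real_inner) \<Rightarrow> bool" where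
  "tangential_bound \<beta> A \<longleftrightarrow>
     (\<exists>\<gamma> > 0. \<exists>C > 0. \<exists>R > 0. \<forall>r > R. \<forall>y \<in> sphere 0 r.
        norm (tangential_part A y) \<le> C * r powr (\<beta> - \<gamma>))"

text \<open>Only the values on \<open>[0, \<infinity>)\<close> matter.  The Isabelle convention \<open>0 powr p = 0\<close> is harmless
  in the growth bound, because \<open>\<xi> 0 = 0\<close>.  If \<open>\<delta> > 1 / (1 - \<beta>)\<close>, the exponent is negative and the bound does not control \<open>\<xi>\<close> near
  \<open>t = 0\<close> uniformly over all noises; a threshold radius common to all of them then need not exist.\<close>

definition noise :: "real \<Rightarrow> real \<Rightarrow> real \<Rightarrow> (real \<Rightarrow> 'a::euclidean_space) \<Rightarrow> bool" where
  "noise \<beta> \<delta> C \<xi> \<longleftrightarrow>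
     \<xi> \<in> borel_measurable (lebesgue_on {0..}) \<and>
     (\<forall>T \<ge> 0. bounded (\<xi> ` {0..T})) \<and>
     \<xi> 0 = 0 \<and>
     (\<forall>t \<ge> 0. norm (\<xi> t) \<le> C * (1 + t powr (1 / (1 - \<beta>) - \<delta>)))"

definition is_solution ::
  "('a \<Rightarrow> 'a) \<Rightarrow> (real \<Rightarrow> 'a) \<Rightarrow> 'a \<Rightarrow> (real \<Rightarrow> 'a::euclidean_space) \<Rightarrow> bool" where
  "is_solution A \<xi> x Z \<longleftrightarrow>
     (\<forall>t \<ge> 0. set_integrable lebesgue {0..t} (\<lambda>s. A (Z s)) \<and>
        Z t = x + (LINT s:{0..t}|lebesgue. A (Z s)) + \<xi> t)"

definition vec_asymp :: "(real \<Rightarrow> 'a) \<Rightarrow> (real \<Rightarrow> 'a::real_normed_vector) \<Rightarrow> bool" where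
  "vec_asymp f g \<longleftrightarrow> (\<lambda>t. norm (f t - g t)) \<in> o[at_top](\<lambda>t. norm (g t))"

definition power_law_escape ::
  "real \<Rightarrow> ('a \<Rightarrow> real) \<Rightarrow> (real \<Rightarrow> 'a::real_normed_vector) \<Rightarrow> bool" where
  "power_law_escape \<beta> abar Z \<longleftrightarrow>
     filterlim (\<lambda>t. norm (Z t)) at_top at_top \<and>
     (\<exists>\<phi>. ((\<lambda>t. sgn (Z t)) \<longlongrightarrow> \<phi>) at_top \<and>
          vec_asymp Z (\<lambda>t. (((1 - \<beta>) * abar \<phi> * t) powr (1 / (1 - \<beta>))) *\<^sub>R \<phi>))"

end

theory Submission imports Defs begin

text \<open>Put \<open>Y = Z - \<xi>\<close>, an absolutely continuous path.  As long as \<open>\<bar>\<xi>\<bar> \<le> \<bar>Y\<bar> / 2\<close> and \<open>\<bar>Y\<bar>\<close> is large,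
  \<open>\<bar>Y\<bar>\<close> to the power \<open>1 - \<beta>\<close> grows at least linearly; the noise is of smaller order, so starting
  far enough out a continuity argument makes this hold for all times.  The angular speed of \<open>Y\<close> is then
  bounded by \<open>t\<close> to the power \<open>- 1 - \<eta>\<close> for some \<open>\<eta> > 0\<close>, hence integrable, so the direction
  converges to some \<open>\<phi>\<close>.  Along the path the derivative of \<open>\<bar>Y\<bar>\<close> to the power \<open>1 - \<beta>\<close> therefore tends
  to \<open>(1 - \<beta>) abar \<phi>\<close>, and averaging gives the asymptotics.\<close>

section \<open>A chain rule for indefinite integrals\<close>

text \<open>The noise is merely measurable and locally bounded, so \<open>Z\<close> may jump and has
  no chain rule; subtracting \<open>\<xi>\<close> moves the irregularity into the argument of
  \<open>A\<close>, which only occurs under integrals. The power 1 - \<beta> is the one that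
  straightens the radial equation r' = a r^\<beta> into (r^(1-\<beta>))' = (1-\<beta>) a. The main
  obstacle is that the drift is evaluated at Y + \<xi> while the direction of \<open>Y\<close> is
  tracked: the strong radial drift is not quite radial for \<open>Y\<close>, and its transverse
  part, divided by |Y|, has size |Y|^(\<beta>-2) |\<xi>|. Since |Y| is at least of order
  t^(1/(1-\<beta>)), the gain t^(-\<delta>) of the noise over that order is just what makes this
  integrable. The limit of \<open>a\<close> along the path is available only once the direction is
  known to converge, so the growth estimate before it has to rely on bounds for \<open>a\<close>
  that are uniform over all directions.\<close>

lemma continuous_on_antiderivative:
  fixes g Y :: "real \<Rightarrow> 'a::banach"
  assumes Y: "\<And>u v. a \<le> u \<Longrightarrow> u \<le> v \<Longrightarrow> v \<le> b \<Longrightarrow> (g has_integral Y v - Y u) {u..v}"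
  shows "continuous_on {a..b} Y"
proof (cases "a \<le> b")
  case True
  then have "g integrable_on {a..b}"
    using Y by blast
  then have "continuous_on {a..b} (\<lambda>t. Y a + integral {a..t} g)"
    by (intro continuous_intros indefinite_integral_continuous_1)
  moreover have "Y a + integral {a..t} g = Y t" if "t \<in> {a..b}" for t
    using integral_unique[OF Y[of a t]] that by simp
  ultimately show ?thesis
    by (metis (no_types, lifting) continuous_on_cong)
qed simp

lemma gradient_increment_bound:
  fixes F :: "'a::real_inner \<Rightarrow> real"
  assumes F: "\<And>y. y \<in> ball p r \<Longrightarrow> (F has_derivative (\<lambda>h. G y \<bullet> h)) (at y)"
    and G: "\<And>y. y \<in> ball p r \<Longrightarrow> norm (G y - c) \<le> e"
    and "y \<in> ball p r" "z \<in> ball p r"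
  shows "\<bar>F y - F z - c \<bullet> (y - z)\<bar> \<le> e * norm (y - z)"
proof -
  have "norm ((F y - c \<bullet> y) - (F z - c \<bullet> z)) \<le> e * norm (y - z)"
  proof (rule differentiable_bound[where S = "ball p r" and f' = "\<lambda>w h. (G w - c) \<bullet> h"])
    fix w assume w: "w \<in> ball p r"
    show "((\<lambda>y. F y - c \<bullet> y) has_derivative (\<lambda>h. (G w - c) \<bullet> h)) (at w within ball p r)"
      using has_derivative_at_withinI[OF F[OF w]]
      by (auto intro!: derivative_eq_intros simp: inner_diff_left)
    show "onorm (\<lambda>h. (G w - c) \<bullet> h) \<le> e"
    proof (rule onorm_bound)
      show "0 \<le> e"
        using G[OF w] norm_ge_zero order_trans by blast
    next
      fix h
      have "norm ((G w - c) \<bullet> h) \<le> norm (G w - c) * norm h"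
        by (simp add: Cauchy_Schwarz_ineq2)
      then show "norm ((G w - c) \<bullet> h) \<le> e * norm h"
        using mult_right_mono[OF G[OF w] norm_ge_zero[of h]] by linarith
    qed
  qed (use assms in auto)
  then show ?thesis
    by (simp add: inner_diff_right algebra_simps)
qed

text \<open>\<open>Y\<close> is only absolutely continuous, so it need not be differentiable where it is needed;
  the Riemann-sum error is summed up by bisection instead.\<close>

lemma has_integral_chain_rule:
  fixes g Y :: "real \<Rightarrow> 'a::euclidean_space"
  assumes "a \<le> b"
    and g: "g absolutely_integrable_on {a..b}"
    and Y: "\<And>u v. a \<le> u \<Longrightarrow> u \<le> v \<Longrightarrow> v \<le> b \<Longrightarrow> (g has_integral Y v - Y u) {u..v}"
    and S: "open S" "\<And>t. t \<in> {a..b} \<Longrightarrow> Y t \<in> S"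
    and F: "\<And>y. y \<in> S \<Longrightarrow> (F has_derivative (\<lambda>h. G y \<bullet> h)) (at y)"
    and G: "continuous_on S G"
  shows "((\<lambda>s. G (Y s) \<bullet> g s) has_integral F (Y b) - F (Y a)) {a..b}"
proof -
  define k where "k s = G (Y s) \<bullet> g s" for s
  define n where "n s = norm (g s)" for s
  have contY: "continuous_on {a..b} Y"
    by (rule continuous_on_antiderivative[OF Y])
  have contGY: "continuous_on {a..b} (\<lambda>s. G (Y s))"
    using continuous_on_compose2[OF G contY] S(2) by blast
  have "k absolutely_integrable_on {a..b}"
    unfolding k_def
  proof (rule absolutely_integrable_bounded_measurable_product[where h = "(\<bullet>)", OF _ _ _ _ g])
    show "bilinear ((\<bullet>) :: 'a \<Rightarrow> 'a \<Rightarrow> real)"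
      using bilinear_conv_bounded_bilinear bounded_bilinear_inner by blast
    show "bounded ((\<lambda>s. G (Y s)) ` {a..b})"
      by (intro compact_imp_bounded compact_continuous_image contGY compact_Icc)
  qed (auto intro: continuous_imp_measurable_on_sets_lebesgue contGY)
  then have k: "k integrable_on {a..b}"
    using set_lebesgue_integral_eq_integral(1) by blast
  have n: "n integrable_on {a..b}"
    unfolding n_def using g absolutely_integrable_on_def by blast
  have sub: "k integrable_on {u..v}" "n integrable_on {u..v}" "g integrable_on {u..v}"
    if "a \<le> u" "v \<le> b" for u v
    using integrable_subinterval_real[OF k, of u v] integrable_subinterval_real[OF n, of u v]
      integrable_subinterval_real[OF set_lebesgue_integral_eq_integral(1)[OF g], of u v] that by auto
  have bound: "\<bar>F (Y b) - F (Y a) - integral {a..b} k\<bar> \<le> e * integral {a..b} n" if "e > 0" for e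
  proof -
    \<comment> \<open>Measured against the integral of \<open>n\<close>, the error bound is additive
      in the interval, so it survives the joining of two intervals without loss.\<close>
    define P where "P u v \<longleftrightarrow> (a \<le> u \<longrightarrow> v \<le> b \<longrightarrow>
      \<bar>F (Y v) - F (Y u) - integral {u..v} k\<bar> \<le> e * integral {u..v} n)" for u v
    have "P a b"
      using \<open>a \<le> b\<close>
    proof (induction rule: Bolzano)
      case (trans u v w)
      show ?case
        unfolding P_def
      proof (intro impI)
        assume uw: "a \<le> u" "w \<le> b"
        have "integral {u..v} k + integral {v..w} k = integral {u..w} k"
          "integral {u..v} n + integral {v..w} n = integral {u..w} n"
          using trans uw sub[of u w] by (auto intro!: Henstock_Kurzweil_Integration.integral_combine)
        moreover have "\<bar>F (Y v) - F (Y u) - integral {u..v} k\<bar> \<le> e * integral {u..v} n"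
          "\<bar>F (Y w) - F (Y v) - integral {v..w} k\<bar> \<le> e * integral {v..w} n"
          using trans uw by (auto simp: P_def)
        moreover have "e * integral {u..w} n = e * integral {u..v} n + e * integral {v..w} n"
          using calculation(2) by (metis distrib_left)
        ultimately show "\<bar>F (Y w) - F (Y u) - integral {u..w} k\<bar> \<le> e * integral {u..w} n"
          by linarith
      qed
    next
      case (local s)
      then have s: "s \<in> {a..b}" by simp
      have "isCont G (Y s)"
        using G S s continuous_on_eq_continuous_at by blast
      \<comment> \<open>Half of \<open>e\<close> pays for linearising \<open>F\<close> at
        \<open>Y s\<close>, the other half for replacing \<open>G (Y t)\<close> by
        \<open>G (Y s)\<close> under the integral.\<close>
      then obtain r1 where r1: "r1 > 0" "\<And>y. dist y (Y s) < r1 \<Longrightarrow> dist (G y) (G (Y s)) < e/2"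
        using \<open>e > 0\<close> unfolding continuous_at_eps_delta by (metis half_gt_zero)
      obtain r2 where r2: "r2 > 0" "ball (Y s) r2 \<subseteq> S"
        using S s open_contains_ball by metis
      define r where "r = min r1 r2"
      have r: "r > 0" "ball (Y s) r \<subseteq> S"
        "\<And>y. y \<in> ball (Y s) r \<Longrightarrow> norm (G y - G (Y s)) \<le> e/2"
        using r1 r2 less_imp_le by (auto simp: r_def dist_commute dist_norm norm_minus_commute)
      obtain d where d: "d > 0" "\<And>t. t \<in> {a..b} \<Longrightarrow> dist t s < d \<Longrightarrow> dist (Y t) (Y s) < r"
        using contY s r(1) unfolding continuous_on_iff by metis
      have "P u v" if uv: "u \<le> s \<and> s \<le> v \<and> v - u < d" for u v
        unfolding P_def
      proof (intro impI)
        assume ab: "a \<le> u" "v \<le> b"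
        have near: "Y t \<in> ball (Y s) r" if "t \<in> {u..v}" for t
          using d(2)[of t] that uv ab by (auto simp: dist_real_def dist_commute)
        have gi: "(g has_integral Y v - Y u) {u..v}"
          using Y uv ab by auto
        have "norm (Y v - Y u) \<le> integral {u..v} n"
          using integral_norm_bound_integral[OF sub(3,2)[OF ab]] integral_unique[OF gi]
          by (simp add: n_def)
        moreover have "\<bar>F (Y v) - F (Y u) - G (Y s) \<bullet> (Y v - Y u)\<bar> \<le> e/2 * norm (Y v - Y u)"
          by (rule gradient_increment_bound[where p = "Y s" and r = r])
            (use F r near uv in auto)
        ultimately have 1: "\<bar>F (Y v) - F (Y u) - G (Y s) \<bullet> (Y v - Y u)\<bar> \<le> e/2 * integral {u..v} n"
          using \<open>e > 0\<close> by (smt (verit, best) half_gt_zero mult_left_mono)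
        have ci: "((\<lambda>t. G (Y s) \<bullet> g t) has_integral G (Y s) \<bullet> (Y v - Y u)) {u..v}"
          using has_integral_linear[OF gi bounded_linear_inner_right[of "G (Y s)"]]
          by (simp add: o_def)
        have "\<bar>integral {u..v} (\<lambda>t. k t - G (Y s) \<bullet> g t)\<bar> \<le> integral {u..v} (\<lambda>t. e/2 * n t)"
          unfolding real_norm_def[symmetric]
        proof (rule integral_norm_bound_integral)
          fix t assume "t \<in> {u..v}"
          have "norm (k t - G (Y s) \<bullet> g t) \<le> norm (G (Y t) - G (Y s)) * norm (g t)"
            by (simp add: k_def flip: inner_diff_left add: Cauchy_Schwarz_ineq2)
          also have "\<dots> \<le> e/2 * n t"
            unfolding n_def using r(3)[OF near[OF \<open>t \<in> {u..v}\<close>]] by (intro mult_right_mono) auto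
          finally show "norm (k t - G (Y s) \<bullet> g t) \<le> e/2 * n t" .
        qed (use sub[OF ab] ci in \<open>auto intro!: integrable_diff integrable_on_mult_right\<close>)
        then have "\<bar>integral {u..v} k - G (Y s) \<bullet> (Y v - Y u)\<bar> \<le> e/2 * integral {u..v} n"
          using Henstock_Kurzweil_Integration.integral_diff[OF sub(1)[OF ab], of "\<lambda>t. G (Y s) \<bullet> g t"]
            integral_unique[OF ci] ci by (auto simp: has_integral_integrable)
        then show "\<bar>F (Y v) - F (Y u) - integral {u..v} k\<bar> \<le> e * integral {u..v} n"
          using 1 by argo
      qed
      then show ?case
        using d(1) by blast
    qed
    then show ?thesis
      by (simp add: P_def)
  qed
  have "\<bar>F (Y b) - F (Y a) - integral {a..b} k\<bar> \<le> 0"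
  proof (rule field_le_epsilon)
    fix e :: real assume "e > 0"
    let ?N = "integral {a..b} n"
    have "?N \<ge> 0"
      by (rule integral_nonneg[OF n]) (simp add: n_def)
    then have "e / (?N + 1) * ?N \<le> e"
      using \<open>e > 0\<close> by (simp add: field_simps)
    moreover have "e / (?N + 1) > 0"
      using \<open>e > 0\<close> \<open>?N \<ge> 0\<close> by simp
    ultimately show "\<bar>F (Y b) - F (Y a) - integral {a..b} k\<bar> \<le> 0 + e"
      using bound[of "e / (?N + 1)"] by linarith
  qed
  then show ?thesis
    using k by (simp add: has_integral_integral k_def[abs_def])
qed

section \<open>Norms, powers and the radial coefficient\<close>

lemma has_derivative_norm_powr:
  fixes y :: "'a::real_inner"
  assumes "y \<noteq> 0"
  shows "((\<lambda>y. norm y powr q) has_derivative (\<lambda>h. ((q * norm y powr (q - 2)) *\<^sub>R y) \<bullet> h)) (at y)"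
proof -
  have "norm y powr q / norm y = norm y powr (q - 2) * norm y"
    using assms by (simp add: powr_diff powr_numeral power2_eq_square)
  then have "norm y powr q * (h \<bullet> sgn y * q / norm y) = ((q * norm y powr (q - 2)) *\<^sub>R y) \<bullet> h" for h
    using assms by (simp add: sgn_div_norm inner_commute field_simps)
  then show ?thesis
    using has_derivative_powr[OF has_derivative_norm[OF assms] has_derivative_const[of q]] assms
    by simp
qed

text \<open>Radial motion does not turn the direction, hence the projection; the division by
  \<open>norm y\<close> converts transverse speed into angular speed.\<close>

lemma has_derivative_inner_sgn:
  fixes y :: "'a::real_inner"
  assumes "y \<noteq> 0"
  shows "((\<lambda>y. u \<bullet> sgn y) has_derivative (\<lambda>h. ((u - (u \<bullet> sgn y) *\<^sub>R sgn y) /\<^sub>R norm y) \<bullet> h)) (at y)"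
  unfolding sgn_div_norm
  by (rule derivative_eq_intros has_derivative_norm refl assms | simp add: assms)+
     (simp add: assms fun_eq_iff inner_simps sgn_div_norm inner_commute field_simps power2_eq_square)

lemma norm_orthogonal_component_le:
  fixes v w :: "'a::real_inner"
  shows "norm (v - (v \<bullet> sgn w) *\<^sub>R sgn w) \<le> norm v"
proof (cases "w = 0")
  case False
  then have "sgn w \<bullet> sgn w = 1"
    by (simp add: dot_square_norm norm_sgn)
  then have "(v - (v \<bullet> sgn w) *\<^sub>R sgn w) \<bullet> (v - (v \<bullet> sgn w) *\<^sub>R sgn w) = v \<bullet> v - (v \<bullet> sgn w)\<^sup>2"
    by (simp add: inner_simps inner_commute power2_eq_square algebra_simps)
  then show ?thesis
    by (simp add: norm_le)
qed simp

text \<open>Exponents of either sign occur, hence the absolute value: for \<open>e < 0\<close> the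
  power is decreasing and the other comparison of \<open>y\<close> and \<open>z\<close> does the
  work.\<close>

lemma powr_le_of_comparable:
  fixes y z e :: real
  assumes "0 < y" "y \<le> 2 * z" "z \<le> 2 * y"
  shows "z powr e \<le> 2 powr \<bar>e\<bar> * y powr e"
proof (cases "e \<ge> 0")
  case True
  then have "z powr e \<le> (2 * y) powr e"
    using assms by (intro powr_mono2) auto
  then show ?thesis
    using True assms by (simp add: powr_mult)
next
  case False
  then have "z powr e \<le> (y / 2) powr e"
    using assms by (intro powr_mono2') auto
  then show ?thesis
    using False assms by (simp add: powr_divide powr_minus field_simps)
qed

text \<open>At late times the term \<open>\<kappa> * t\<close> alone wins, because
  \<open>\<delta> > 0\<close>. Up to such a time \<open>T\<close> the left side is bounded by its
  value at \<open>T\<close>, the exponent \<open>p - \<delta>\<close> being nonnegative, and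
  \<open>M\<close> is chosen to beat that value.\<close>

lemma sublinear_noise_dominated:
  fixes p \<delta> \<kappa> C :: real
  assumes "p > 0" "\<delta> > 0" "\<delta> \<le> p" "\<kappa> > 0" "C > 0"
  obtains M where "M > 0"
    "\<And>m t. m \<ge> M \<Longrightarrow> t \<ge> 0 \<Longrightarrow> C * (1 + t powr (p - \<delta>)) \<le> (m + \<kappa> * t) powr p / 2"
proof -
  have "((\<lambda>t::real. C * (t powr - p + t powr - \<delta>)) \<longlongrightarrow> C * (0 + 0)) at_top"
    using assms by (intro tendsto_intros tendsto_neg_powr filterlim_ident) auto
  then have "\<forall>\<^sub>F t in at_top. C * (t powr - p + t powr - \<delta>) < \<kappa> powr p / 2"
    using assms by (intro order_tendstoD(2)[of _ "C * (0 + 0)"]) auto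
  then obtain T0 where T0: "\<And>t. t \<ge> T0 \<Longrightarrow> C * (t powr - p + t powr - \<delta>) < \<kappa> powr p / 2"
    unfolding eventually_at_top_linorder by blast
  define T where "T = max T0 1"
  define M where "M = (2 * C * (1 + T powr (p - \<delta>))) powr (1 / p)"
  have T_pos: "1 + T powr (p - \<delta>) > 0"
    by (simp add: add_pos_nonneg)
  then have "M > 0"
    using assms by (simp add: M_def)
  moreover have "C * (1 + t powr (p - \<delta>)) \<le> (m + \<kappa> * t) powr p / 2" if "m \<ge> M" "t \<ge> 0" for m t
  proof (cases "t \<ge> T")
    case True
    then have t: "t > 0" "t \<ge> T0"
      by (auto simp: T_def)
    have "C * (1 + t powr (p - \<delta>)) = C * (t powr - p + t powr - \<delta>) * t powr p"
      using t by (simp add: powr_diff powr_minus field_simps)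
    also have "\<dots> \<le> \<kappa> powr p / 2 * t powr p"
      using T0[OF t(2)] by (intro mult_right_mono) auto
    also have "\<dots> = (\<kappa> * t) powr p / 2"
      using t assms by (simp add: powr_mult)
    also have "\<dots> \<le> (m + \<kappa> * t) powr p / 2"
      using t assms that \<open>M > 0\<close> by (intro divide_right_mono powr_mono2) auto
    finally show ?thesis .
  next
    case False
    have M: "M powr p = 2 * C * (1 + T powr (p - \<delta>))"
      using T_pos assms by (simp add: M_def powr_powr)
    have "C * (1 + t powr (p - \<delta>)) \<le> C * (1 + T powr (p - \<delta>))"
      using False assms that by (intro mult_left_mono add_left_mono powr_mono2) auto
    also have "\<dots> = M powr p / 2"
      by (simp add: M)
    also have "\<dots> \<le> (m + \<kappa> * t) powr p / 2"
      using assms that \<open>M > 0\<close> by (intro divide_right_mono powr_mono2 add_increasing2) auto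
    finally show ?thesis .
  qed
  ultimately show ?thesis
    using that by blast
qed

text \<open>The zeros in \<open>{0..t}\<close> form a nonempty compact set, and \<open>T\<close> is
  the least of them; a negative value earlier would produce an earlier zero by the intermediate
  value theorem.\<close>

lemma first_zero:
  fixes h :: "real \<Rightarrow> real"
  assumes "continuous_on {0..t} h" "0 < h 0" "h t \<le> 0" "0 \<le> t"
  obtains T where "0 \<le> T" "T \<le> t" "h T = 0" "\<And>s. 0 \<le> s \<Longrightarrow> s \<le> T \<Longrightarrow> 0 \<le> h s"
proof -
  define Z where "Z = {s \<in> {0..t}. h s = 0}"
  have zero: "\<exists>r\<in>Z. r \<le> s" if "0 \<le> s" "s \<le> t" "h s \<le> 0" for s
  proof -
    have "continuous_on {0..s} h"
      using assms(1) that by (auto intro: continuous_on_subset)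
    then have "\<exists>r\<ge>0. r \<le> s \<and> h r = 0"
      using that assms(2) by (intro IVT2') auto
    then show ?thesis
      using that by (auto simp: Z_def)
  qed
  have "closed Z"
    unfolding Z_def by (rule continuous_closed_preimage_constant[OF assms(1)]) simp
  moreover have "bounded Z"
    unfolding Z_def by (rule bounded_subset[OF bounded_closed_interval[of 0 t]]) auto
  ultimately have "compact Z"
    by (simp add: compact_eq_bounded_closed)
  moreover obtain r where "r \<in> Z"
    using zero[of t] assms(3,4) by blast
  ultimately obtain T where T: "T \<in> Z" "\<And>s. s \<in> Z \<Longrightarrow> T \<le> s"
    using compact_attains_inf[of Z] by (metis empty_iff)
  then have T': "0 \<le> T" "T \<le> t" "h T = 0"
    by (simp_all add: Z_def)
  have "0 \<le> h s" if s: "0 \<le> s" "s \<le> T" for s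
  proof (rule ccontr)
    assume neg: "\<not> 0 \<le> h s"
    then obtain r where "r \<in> Z" "r \<le> s"
      using zero[of s] s T' by force
    then have "s = T"
      using T(2)[of r] s by linarith
    then show False
      using T' neg by simp
  qed
  then show ?thesis
    using that T' by blast
qed

text \<open>Compactness of the sphere. The joint limit bounds \<open>a\<close> only on a cone around
  each direction and outside a ball (\<open>good U\<close>); finitely many such cones cover all
  directions, and \<open>abar > 0\<close> makes the lower bounds positive.\<close>

lemma radial_coefficient_bounds:
  fixes A :: "'a::euclidean_space \<Rightarrow> 'a"
  assumes "radial_growth \<beta> a abar A"
  obtains R L K where "R > 0" "L > 0" "\<And>z. norm z \<ge> R \<Longrightarrow> L \<le> a z \<and> a z \<le> K"
proof -
  define good where "good U \<longleftrightarrow>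
    (\<exists>R>0. \<exists>L>0. \<exists>K. \<forall>z. norm z \<ge> R \<longrightarrow> sgn z \<in> U \<longrightarrow> L \<le> a z \<and> a z \<le> K)" for U
  have "\<exists>U. open U \<and> \<phi> \<in> U \<and> good U" if \<phi>: "\<phi> \<in> sphere 0 1" for \<phi>
  proof -
    have pos: "abar \<phi> > 0"
      and lim: "(a \<longlongrightarrow> abar \<phi>) (inf at_infinity (filtercomap sgn (nhds \<phi>)))"
      using assms \<phi> by (auto simp: radial_growth_def)
    have "\<forall>\<^sub>F z in inf at_infinity (filtercomap sgn (nhds \<phi>)).
        abar \<phi> / 2 < a z \<and> a z < 2 * abar \<phi>"
      using pos by (intro eventually_conj order_tendstoD[OF lim]) auto
    then obtain b U where b: "\<And>z. norm z \<ge> b \<Longrightarrow> sgn z \<in> U \<Longrightarrow> abar \<phi> / 2 < a z \<and> a z < 2 * abar \<phi>"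
      and U: "open U" "\<phi> \<in> U"
      unfolding eventually_inf eventually_at_infinity eventually_filtercomap eventually_nhds
      by metis
    have "\<forall>z. norm z \<ge> max b 1 \<longrightarrow> sgn z \<in> U \<longrightarrow> abar \<phi> / 2 \<le> a z \<and> a z \<le> 2 * abar \<phi>"
      using b by (simp add: less_imp_le)
    then have "good U"
      unfolding good_def using pos by (metis half_gt_zero max.strict_coboundedI2 zero_less_one)
    then show ?thesis
      using U by blast
  qed
  then obtain U where U: "\<And>\<phi>. \<phi> \<in> sphere 0 1 \<Longrightarrow> open (U \<phi>) \<and> \<phi> \<in> U \<phi> \<and> good (U \<phi>)"
    by metis
  have "sphere 0 1 \<subseteq> (\<Union>\<phi>\<in>sphere 0 1. U \<phi>)"
    using U by blast
  then obtain D where D: "D \<subseteq> sphere 0 1" "finite D" "sphere 0 1 \<subseteq> (\<Union>\<phi>\<in>D. U \<phi>)"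
    using compactE_image[OF compact_sphere, of "sphere 0 1" U 0 1] U by blast
  have "good (\<Union>\<phi>\<in>D. U \<phi>)"
    using D(2,1)
  proof (induction rule: finite_induct)
    case empty
    show ?case
      unfolding good_def by (auto intro: exI[of _ 1])
  next
    case (insert \<phi> D)
    then have "good (U \<phi>)" "good (\<Union>\<phi>\<in>D. U \<phi>)"
      by (simp_all add: U)
    then obtain R L K R' L' K' where pos: "R > 0" "L > 0" "R' > 0" "L' > 0"
      and b: "\<forall>z. norm z \<ge> R \<longrightarrow> sgn z \<in> U \<phi> \<longrightarrow> L \<le> a z \<and> a z \<le> K"
      and b': "\<forall>z. norm z \<ge> R' \<longrightarrow> sgn z \<in> (\<Union>\<phi>\<in>D. U \<phi>) \<longrightarrow> L' \<le> a z \<and> a z \<le> K'"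
      unfolding good_def by (elim exE conjE) (rule that)
    have "min L L' \<le> a z \<and> a z \<le> max K K'"
      if "norm z \<ge> max R R'" "sgn z \<in> (\<Union>\<phi>\<in>insert \<phi> D. U \<phi>)" for z
    proof (cases "sgn z \<in> U \<phi>")
      case True
      then have "L \<le> a z \<and> a z \<le> K"
        using b that by simp
      then show ?thesis
        by linarith
    next
      case False
      then have "L' \<le> a z \<and> a z \<le> K'"
        using b' that by simp
      then show ?thesis
        by linarith
    qed
    then have "\<forall>z. norm z \<ge> max R R' \<longrightarrow> sgn z \<in> (\<Union>\<phi>\<in>insert \<phi> D. U \<phi>) \<longrightarrow>
        min L L' \<le> a z \<and> a z \<le> max K K'"
      by blast
    moreover have "max R R' > 0" "min L L' > 0"
      using pos by auto
    ultimately show ?case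
      unfolding good_def by (intro exI conjI)
  qed
  then obtain R L K where "R > 0" "L > 0"
    and bnd: "\<And>z. norm z \<ge> R \<Longrightarrow> sgn z \<in> (\<Union>\<phi>\<in>D. U \<phi>) \<Longrightarrow> L \<le> a z \<and> a z \<le> K"
    unfolding good_def by blast
  have "L \<le> a z \<and> a z \<le> K" if "norm z \<ge> R" for z
  proof -
    have "sgn z \<in> sphere 0 1"
      using that \<open>R > 0\<close> by (auto simp: norm_sgn)
    then show ?thesis
      using D(3) bnd[OF that] by blast
  qed
  then show ?thesis
    using \<open>R > 0\<close> \<open>L > 0\<close> that by blast
qed

section \<open>Growth of the radius\<close>

locale drift =
  fixes A :: "'a::euclidean_space \<Rightarrow> 'a" and a :: "'a \<Rightarrow> real" and \<beta> \<gamma> R L K C :: real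
  assumes \<gamma>_pos: "\<gamma> > 0" and R_pos: "R > 0" and L_pos: "L > 0" and C_pos: "C > 0"
    and radial: "z \<noteq> 0 \<Longrightarrow> radial_part A z = (a z * norm z powr \<beta>) *\<^sub>R sgn z"
    and a_bounds: "norm z \<ge> R \<Longrightarrow> L \<le> a z \<and> a z \<le> K"
    and tangential: "norm z \<ge> R \<Longrightarrow> norm (tangential_part A z) \<le> C * norm z powr (\<beta> - \<gamma>)"
begin

lemma decomposition:
  assumes "z \<noteq> 0"
  shows "A z = (a z * norm z powr \<beta>) *\<^sub>R sgn z + tangential_part A z"
  using radial[OF assms] by (simp add: tangential_part_def)

text \<open>The right-hand side is the derivative of |y|^(1-\<beta>) along the drift, divided by 1 -
  \<beta>. As \<open>w\<close> is at most half as long as \<open>y\<close>, the angle between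
  \<open>y\<close> and \<open>y + w\<close> stays away from a right angle, so the radial drift
  pushes \<open>y\<close> outwards; the tangential drift is smaller by a factor of order |y +
  w|^(-\<gamma>).\<close>

lemma outward_drift:
  obtains R' \<kappa> where "R' \<ge> 2 * R" "\<kappa> > 0"
    "\<And>y w. norm y \<ge> R' \<Longrightarrow> norm w \<le> norm y / 2 \<Longrightarrow>
        \<kappa> \<le> norm y powr (- 1 - \<beta>) * (y \<bullet> A (y + w))"
proof -
  have "((\<lambda>r::real. C * r powr - \<gamma>) \<longlongrightarrow> C * 0) at_top"
    using \<gamma>_pos by (intro tendsto_intros tendsto_neg_powr filterlim_ident) auto
  then have "\<forall>\<^sub>F r in at_top. C * r powr - \<gamma> < L / 8"
    using L_pos by (intro order_tendstoD(2)[of _ "C * 0"]) auto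
  then obtain R1 where R1: "\<And>r. r \<ge> R1 \<Longrightarrow> C * r powr - \<gamma> < L / 8"
    unfolding eventually_at_top_linorder by blast
  \<comment> \<open>With \<open>z = y + w\<close>, the radial part contributes at least L/4, because
    \<open>y \<bullet> sgn z\<close> is at least |y|/4, and the tangential part costs at most L/8.
    The power of 2 pays for exchanging |z|^\<beta> with |y|^\<beta>.\<close>
  define \<kappa> where "\<kappa> = L / 8 / 2 powr \<bar>\<beta>\<bar>"
  have "\<kappa> \<le> norm y powr (- 1 - \<beta>) * (y \<bullet> A (y + w))"
    if y: "norm y \<ge> 2 * max R R1" and w: "norm w \<le> norm y / 2" for y w
  proof -
    define z where "z = y + w"
    have "norm y - norm w \<le> norm z" "norm z \<le> norm y + norm w"
      by (auto simp: z_def norm_diff_ineq norm_triangle_ineq)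
    then have z: "norm z \<ge> R" "norm z \<ge> R1" "norm y \<le> 2 * norm z" "norm z \<le> 2 * norm y"
      using y w by auto
    have pos: "norm y > 0" "norm z > 0"
      using R_pos y z by auto
    have "\<bar>y \<bullet> w\<bar> \<le> norm y * (norm y / 2)"
      using Cauchy_Schwarz_ineq2[of y w] w by (meson mult_left_mono norm_ge_zero order_trans)
    then have "y \<bullet> z \<ge> norm y * norm y / 2"
      by (simp add: z_def inner_add_right power2_norm_eq_inner[symmetric] power2_eq_square)
    moreover have "norm y * norm y / 2 \<ge> norm y / 4 * norm z"
      using mult_left_mono[OF z(4), of "norm y / 4"] by simp
    ultimately have "norm y / 4 * norm z \<le> y \<bullet> z"
      by linarith
    then have "norm y / 4 \<le> y \<bullet> sgn z"
      using pos by (simp add: sgn_div_norm pos_le_divide_eq flip: divide_inverse_commute)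
    then have "L * norm z powr \<beta> * (norm y / 4) \<le> a z * norm z powr \<beta> * (y \<bullet> sgn z)"
      using a_bounds[OF z(1)] L_pos pos by (intro mult_mono mult_right_mono) auto
    moreover have "\<bar>y \<bullet> tangential_part A z\<bar> \<le> norm y * (norm z powr \<beta> * (L / 8))"
    proof -
      have "\<bar>y \<bullet> tangential_part A z\<bar> \<le> norm y * (C * norm z powr (\<beta> - \<gamma>))"
        using Cauchy_Schwarz_ineq2 tangential[OF z(1)]
        by (meson mult_left_mono norm_ge_zero order_trans)
      also have "C * norm z powr (\<beta> - \<gamma>) = norm z powr \<beta> * (C * norm z powr - \<gamma>)"
        by (simp add: powr_diff powr_minus field_simps)
      also have "norm y * \<dots> \<le> norm y * (norm z powr \<beta> * (L / 8))"
        using R1[OF z(2)] by (intro mult_left_mono) auto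
      finally show ?thesis .
    qed
    moreover have "y \<bullet> A z = a z * norm z powr \<beta> * (y \<bullet> sgn z) + y \<bullet> tangential_part A z"
      using pos by (subst decomposition) (auto simp: inner_add_right)
    ultimately have "norm y * norm z powr \<beta> * (L / 8) \<le> y \<bullet> A z"
      by argo
    then have "norm y powr (- 1 - \<beta>) * (norm y * norm z powr \<beta> * (L / 8))
        \<le> norm y powr (- 1 - \<beta>) * (y \<bullet> A z)"
      by (intro mult_left_mono) auto
    also have "norm y powr (- 1 - \<beta>) * (norm y * norm z powr \<beta> * (L / 8))
        = norm z powr \<beta> / norm y powr \<beta> * (L / 8)"
      using pos by (simp add: powr_diff powr_minus field_simps)
    finally have "norm z powr \<beta> / norm y powr \<beta> * (L / 8) \<le> norm y powr (- 1 - \<beta>) * (y \<bullet> A z)" .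
    moreover have "1 / 2 powr \<bar>\<beta>\<bar> \<le> norm z powr \<beta> / norm y powr \<beta>"
      using powr_le_of_comparable[of "norm z" "norm y" \<beta>] pos z by (simp add: field_simps)
    from mult_right_mono[OF this, of "L / 8"]
    have "\<kappa> \<le> norm z powr \<beta> / norm y powr \<beta> * (L / 8)"
      using L_pos by (simp add: \<kappa>_def mult.commute)
    ultimately show ?thesis
      by (simp add: z_def)
  qed
  moreover have "\<kappa> > 0"
    using L_pos by (simp add: \<kappa>_def)
  ultimately show ?thesis
    using that[of "2 * max R R1" \<kappa>] by simp
qed

text \<open>The radial part of the drift at \<open>y + w\<close> points along \<open>y + w\<close>, whose component orthogonal
  to \<open>y\<close> is that of \<open>w\<close>; this is where the gain over the size \<open>norm y powr \<beta>\<close> of the drift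
  comes from.\<close>

lemma angular_drift_bound:
  assumes y: "norm y \<ge> 2 * R" and w: "norm w \<le> norm y / 2"
  shows "norm (A (y + w) - (A (y + w) \<bullet> sgn y) *\<^sub>R sgn y) \<le>
    K * 2 powr \<bar>\<beta> - 1\<bar> * norm y powr (\<beta> - 1) * norm w
      + C * 2 powr \<bar>\<beta> - \<gamma>\<bar> * norm y powr (\<beta> - \<gamma>)"
proof -
  define z where "z = y + w"
  define P where "P v = v - (v \<bullet> sgn y) *\<^sub>R sgn y" for v
  have "norm y - norm w \<le> norm z" "norm z \<le> norm y + norm w"
    by (auto simp: z_def norm_diff_ineq norm_triangle_ineq)
  then have z: "norm z \<ge> R" "norm y \<le> 2 * norm z" "norm z \<le> 2 * norm y"
    using y w by auto
  have pos: "norm y > 0" "norm z > 0"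
    using R_pos y z by auto
  have P_le: "norm (P v) \<le> norm v" for v
    unfolding P_def by (rule norm_orthogonal_component_le)
  have P_linear: "P (c *\<^sub>R v + v') = c *\<^sub>R P v + P v'" for c v v'
    by (simp add: P_def inner_simps algebra_simps)
  have "y \<bullet> sgn y = norm y"
    using pos by (simp add: sgn_div_norm dot_square_norm power2_eq_square)
  then have "P y = 0"
    using pos by (simp add: P_def sgn_div_norm)
  then have "P z = P w"
    using P_linear[of 1 y w] by (simp add: z_def)
  \<comment> \<open>Written as a multiple of \<open>z\<close> instead of \<open>sgn z\<close>, the
    radial drift is seen by the projection only through \<open>P z = P w\<close>.\<close>
  have A: "A z = (a z * norm z powr (\<beta> - 1)) *\<^sub>R z + tangential_part A z"
    using pos decomposition[of z] by (simp add: sgn_div_norm powr_diff divide_inverse mult.assoc)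
  have "norm (P (A z)) \<le> norm ((a z * norm z powr (\<beta> - 1)) *\<^sub>R P w) + norm (P (tangential_part A z))"
    by (subst A) (simp only: P_linear \<open>P z = P w\<close> norm_triangle_ineq)
  also have "norm ((a z * norm z powr (\<beta> - 1)) *\<^sub>R P w) = a z * norm z powr (\<beta> - 1) * norm (P w)"
    using a_bounds[OF z(1)] L_pos by simp
  also have "\<dots> \<le> K * (2 powr \<bar>\<beta> - 1\<bar> * norm y powr (\<beta> - 1)) * norm w"
    using a_bounds[OF z(1)] L_pos powr_le_of_comparable[OF pos(1) z(2,3)] P_le
    by (intro mult_mono) (auto intro!: mult_nonneg_nonneg)
  also have "norm (P (tangential_part A z)) \<le> C * norm z powr (\<beta> - \<gamma>)"
    using P_le tangential[OF z(1)] order_trans by blast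
  also have "\<dots> \<le> C * (2 powr \<bar>\<beta> - \<gamma>\<bar> * norm y powr (\<beta> - \<gamma>))"
    using C_pos powr_le_of_comparable[OF pos(1) z(2,3)] by (intro mult_left_mono) auto
  finally show ?thesis
    by (simp add: P_def z_def mult.assoc)
qed

end

text \<open>Continuity argument. As long as |Y| stays above \<open>low\<close>, the noise is at most
  half of |Y| and the drift condition applies, which yields |Y t|^q >= |Y 0|^q + q \<kappa> t. The
  curve \<open>low\<close> asks for only half of this, so it cannot be touched. The noise is
  compared with the deterministic curve \<open>low\<close>, so continuity is needed for
  \<open>Y\<close> alone.\<close>

lemma norm_growth_bootstrap:
  fixes g Y w :: "real \<Rightarrow> 'a::euclidean_space"
  defines "low t q \<kappa> \<equiv> ((norm (Y 0) powr q + q * \<kappa> * t) / 2) powr (1 / q)"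
  assumes "q > 0" "\<kappa> > 0" "R > 0"
    and g: "\<And>t. 0 \<le> t \<Longrightarrow> g absolutely_integrable_on {0..t}"
    and Y: "\<And>u v. 0 \<le> u \<Longrightarrow> u \<le> v \<Longrightarrow> (g has_integral Y v - Y u) {u..v}"
    and drift: "\<And>t. 0 \<le> t \<Longrightarrow> norm (Y t) \<ge> R \<Longrightarrow> norm (w t) \<le> norm (Y t) / 2 \<Longrightarrow>
      \<kappa> \<le> norm (Y t) powr (q - 2) * (Y t \<bullet> g t)"
    and start: "R \<le> low 0 q \<kappa>"
    and noise: "\<And>t. 0 \<le> t \<Longrightarrow> norm (w t) \<le> low t q \<kappa> / 2"
    and "0 \<le> t"
  shows "low t q \<kappa> \<le> norm (Y t)"
proof (rule ccontr)
  assume neg: "\<not> ?thesis"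
  define h where "h s = norm (Y s) - low s q \<kappa>" for s
  have low_mono: "R \<le> low s q \<kappa>" if "0 \<le> s" for s
    using that assms(2,3) unfolding low_def
    by (intro order_trans[OF start[unfolded low_def]] powr_mono2 divide_right_mono) auto
  have "norm (Y 0) > 0"
    using start \<open>R > 0\<close> by (auto simp: low_def)
  have "continuous_on {0..t} Y"
    by (rule continuous_on_antiderivative[of _ _ g]) (use Y in auto)
  moreover have "norm (Y 0) powr q + q * \<kappa> * s > 0" if "s \<ge> 0" for s
    using \<open>norm (Y 0) > 0\<close> assms(2,3) that by (intro add_pos_nonneg) auto
  then have "continuous_on {0..t} (\<lambda>s. low s q \<kappa>)"
    unfolding low_def by (intro continuous_intros) force+
  ultimately have "continuous_on {0..t} h"
    unfolding h_def by (intro continuous_intros)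
  moreover have "low 0 q \<kappa> < norm (Y 0)"
  proof -
    have "low 0 q \<kappa> < (norm (Y 0) powr q) powr (1 / q)"
      using \<open>norm (Y 0) > 0\<close> \<open>q > 0\<close> unfolding low_def by (intro powr_less_mono2) auto
    then show ?thesis
      using \<open>q > 0\<close> by (simp add: powr_powr)
  qed
  ultimately have "continuous_on {0..t} h" "0 < h 0" "h t \<le> 0"
    using neg by (simp_all add: h_def)
  then obtain T where T: "0 \<le> T" "T \<le> t" "h T = 0" "\<And>s. 0 \<le> s \<Longrightarrow> s \<le> T \<Longrightarrow> 0 \<le> h s"
    using first_zero[OF _ _ _ \<open>0 \<le> t\<close>] by blast
  have above: "norm (Y s) \<ge> R" "\<kappa> \<le> norm (Y s) powr (q - 2) * (Y s \<bullet> g s)" if "s \<in> {0..T}" for s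
  proof -
    show "norm (Y s) \<ge> R"
      using that T(4)[of s] low_mono[of s] by (simp add: h_def)
    then show "\<kappa> \<le> norm (Y s) powr (q - 2) * (Y s \<bullet> g s)"
      using that T(4)[of s] noise[of s] by (intro drift) (auto simp: h_def)
  qed
  have gain: "((\<lambda>s. ((q * norm (Y s) powr (q - 2)) *\<^sub>R Y s) \<bullet> g s) has_integral
      norm (Y T) powr q - norm (Y 0) powr q) {0..T}"
  proof (rule has_integral_chain_rule[OF T(1) g[OF T(1)] Y, where S = "- {0}"])
    show "continuous_on (- {0}) (\<lambda>y::'a. (q * norm y powr (q - 2)) *\<^sub>R y)"
      by (intro continuous_intros) auto
    show "Y s \<in> - {0}" if "s \<in> {0..T}" for s
      using above(1)[OF that] \<open>R > 0\<close> by auto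
  qed (rule has_derivative_norm_powr open_Compl | simp)+
  have "((\<lambda>s. q * \<kappa>) has_integral T * (q * \<kappa>)) {0..T}"
    using has_integral_const_real[of "q * \<kappa>" 0 T] T(1) by simp
  then have "T * (q * \<kappa>) \<le> norm (Y T) powr q - norm (Y 0) powr q"
  proof (rule has_integral_le[OF _ gain])
    show "q * \<kappa> \<le> ((q * norm (Y s) powr (q - 2)) *\<^sub>R Y s) \<bullet> g s" if "s \<in> {0..T}" for s
      using mult_left_mono[OF above(2)[OF that], of q] \<open>q > 0\<close> by (simp add: mult.assoc)
  qed
  \<comment> \<open>Contact with \<open>low\<close> at \<open>T\<close> means exactly half of what
    the chain rule has just guaranteed.\<close>
  moreover have "norm (Y T) powr q = norm (Y 0) powr q / 2 + T * (q * \<kappa>) / 2"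
    using T(1,3) assms(2,3) by (simp add: h_def low_def powr_powr add_divide_distrib mult_ac)
  moreover have "norm (Y 0) powr q > 0"
    using \<open>norm (Y 0) > 0\<close> by simp
  moreover have "T * (q * \<kappa>) \<ge> 0"
    using T(1) assms(2,3) by simp
  ultimately show False
    by argo
qed

section \<open>The integral equation in increment form\<close>

lemma is_solution_absolutely_integrable:
  assumes "is_solution A \<xi> x Z" "0 \<le> t"
  shows "(\<lambda>s. A (Z s)) absolutely_integrable_on {0..t}"
  using assms by (simp add: is_solution_def)

lemma is_solution_increment:
  assumes sol: "is_solution A \<xi> x Z" and "0 \<le> u" "u \<le> v"
  shows "((\<lambda>s. A (Z s)) has_integral (Z v - \<xi> v) - (Z u - \<xi> u)) {u..v}"
proof -
  note ai = set_lebesgue_integral_eq_integral[OF is_solution_absolutely_integrable[OF sol]]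
  have Z: "Z t - \<xi> t = x + integral {0..t} (\<lambda>s. A (Z s))" if "0 \<le> t" for t
    using sol that ai(2)[OF that] by (simp add: is_solution_def)
  have "integral {0..u} (\<lambda>s. A (Z s)) + integral {u..v} (\<lambda>s. A (Z s)) = integral {0..v} (\<lambda>s. A (Z s))"
    using assms ai(1)[of v] by (intro Henstock_Kurzweil_Integration.integral_combine) auto
  moreover have "(\<lambda>s. A (Z s)) integrable_on {u..v}"
    using integrable_subinterval_real[OF ai(1)[of v], of u v] assms by auto
  ultimately show ?thesis
    using Z[of u] Z[of v] assms by (simp add: has_integral_integrable_integral algebra_simps)
qed

section \<open>Convergence of the direction\<close>

text \<open>The Cauchy criterion along the integers produces \<open>l\<close>; letting the later
  time run through the integers, the increment bound controls every real time as well.\<close>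

lemma convergent_at_top_of_increment_bound:
  fixes f :: "real \<Rightarrow> 'a::banach"
  assumes e: "(e \<longlongrightarrow> 0) at_top"
    and f: "\<And>s t. t0 \<le> s \<Longrightarrow> s \<le> t \<Longrightarrow> norm (f t - f s) \<le> e s"
  obtains l where "(f \<longlongrightarrow> l) at_top"
proof -
  define X where "X n = f (real n)" for n
  have "Cauchy X"
  proof (rule CauchyI)
    fix r :: real assume "r > 0"
    then have "\<forall>\<^sub>F s in at_top. e s < r / 2 \<and> t0 \<le> s"
      by (intro eventually_conj order_tendstoD(2)[OF e] eventually_ge_at_top) auto
    then obtain s where s: "e s < r / 2" "t0 \<le> s"
      using eventually_happens'[OF trivial_limit_at_top_linorder] by blast
    have "norm (X m - X n) < r" if "m \<ge> nat \<lceil>s\<rceil>" "n \<ge> nat \<lceil>s\<rceil>" for m n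
    proof -
      have "s \<le> real m" "s \<le> real n"
        using that by linarith+
      then have "norm (X m - f s) \<le> e s" "norm (X n - f s) \<le> e s"
        using f s by (auto simp: X_def)
      then show ?thesis
        using norm_triangle_ineq4[of "X m - f s" "X n - f s"] s by simp
    qed
    then show "\<exists>M. \<forall>m\<ge>M. \<forall>n\<ge>M. norm (X m - X n) < r"
      by blast
  qed
  then obtain l where l: "X \<longlonglongrightarrow> l"
    using Cauchy_convergent convergent_def by blast
  have "norm (f s - l) \<le> e s" if "t0 \<le> s" for s
  proof (rule tendsto_upperbound)
    show "(\<lambda>n. norm (f s - X n)) \<longlonglongrightarrow> norm (f s - l)"
      by (intro tendsto_intros l)
    have "\<forall>\<^sub>F n in sequentially. s \<le> real n"
      by real_asymp
    then show "\<forall>\<^sub>F n in sequentially. norm (f s - X n) \<le> e s"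
      by eventually_elim (use f that in \<open>simp add: X_def norm_minus_commute\<close>)
  qed simp
  then have "\<forall>\<^sub>F s in at_top. norm (f s - l) \<le> e s"
    by (rule eventually_at_top_linorderI)
  then have "((\<lambda>s. f s - l) \<longlongrightarrow> 0) at_top"
    by (rule Lim_null_comparison[OF _ e])
  then show ?thesis
    using that LIM_zero_cancel by blast
qed

text \<open>Continuous Cesaro averaging.\<close>

lemma antiderivative_over_identity_tendsto:
  fixes H k :: "real \<Rightarrow> real"
  assumes k: "(k \<longlongrightarrow> l) at_top"
    and H: "\<And>s t. t0 \<le> s \<Longrightarrow> s \<le> t \<Longrightarrow> (k has_integral H t - H s) {s..t}"
  shows "((\<lambda>t. H t / t) \<longlongrightarrow> l) at_top"
proof (rule tendstoI)
  fix e :: real assume "e > 0"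
  have "\<forall>\<^sub>F t in at_top. dist (k t) l < e / 2"
    using k \<open>e > 0\<close> by (intro tendstoD) auto
  then obtain T1 where T1: "\<And>t. t \<ge> T1 \<Longrightarrow> dist (k t) l < e / 2"
    unfolding eventually_at_top_linorder by blast
  define T where "T = max t0 (max T1 1)"
  \<comment> \<open>The error made up to \<open>T\<close> is a fixed number, so it disappears after
    division by \<open>t\<close>.\<close>
  define c where "c = H T - l * T"
  have "((\<lambda>t::real. \<bar>c\<bar> / t) \<longlongrightarrow> 0) at_top"
    by real_asymp
  then have "\<forall>\<^sub>F t in at_top. \<bar>c\<bar> / t < e / 2"
    using \<open>e > 0\<close> by (intro order_tendstoD(2)) auto
  then show "\<forall>\<^sub>F t in at_top. dist (H t / t) l < e"
    using eventually_ge_at_top[of T]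
  proof eventually_elim
    case (elim t)
    have t: "T > 0" "t > 0" "T \<ge> t0" "T \<ge> T1"
      using elim by (auto simp: T_def)
    define x where "x = (H t - H T) - l * (t - T)"
    have "((\<lambda>s. k s - l) has_integral x) {T..t}"
      unfolding x_def using has_integral_diff[OF H[OF t(3) elim(2)] has_integral_const_real[of l T t]] elim
      by (simp add: mult.commute)
    then have "norm x \<le> e / 2 * Henstock_Kurzweil_Integration.content {T..t}"
      using T1 t \<open>e > 0\<close> by (intro has_integral_bound_real[where f = "\<lambda>s. k s - l"])
        (auto simp: dist_real_def less_imp_le)
    then have "\<bar>x\<bar> \<le> e / 2 * (t - T)"
      using elim by simp
    moreover have "H t - l * t = x + c"
      by (simp add: x_def c_def algebra_simps)
    ultimately have "\<bar>H t - l * t\<bar> \<le> e / 2 * (t - T) + \<bar>c\<bar>"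
      by linarith
    also have "\<dots> < e * t"
    proof -
      have "\<bar>c\<bar> < e / 2 * t"
        using elim(1) t by (simp add: field_simps)
      moreover have "e / 2 * (t - T) < e / 2 * t"
        using t \<open>e > 0\<close> by simp
      ultimately show ?thesis
        by argo
    qed
    finally show ?case
      using t by (simp add: dist_real_def field_simps abs_less_iff)
  qed
qed

lemma has_integral_powr_neg:
  fixes M \<eta> s t :: real
  assumes "0 < s" "s \<le> t" "\<eta> > 0"
  shows "((\<lambda>r. M * r powr (- 1 - \<eta>)) has_integral M / \<eta> * (s powr - \<eta> - t powr - \<eta>)) {s..t}"
proof -
  have "((\<lambda>r. M * r powr (- 1 - \<eta>)) has_integral - (M / \<eta>) * t powr - \<eta> - - (M / \<eta>) * s powr - \<eta>) {s..t}"
  proof (rule fundamental_theorem_of_calculus[OF assms(2)])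
    fix r assume "r \<in> {s..t}"
    then have "r > 0"
      using assms by auto
    then have "((\<lambda>r. - (M / \<eta>) * r powr - \<eta>) has_real_derivative
        - (M / \<eta>) * (- \<eta> * r powr (- \<eta> - 1))) (at r within {s..t})"
      by (intro has_field_derivative_at_within[OF DERIV_cmult] has_real_derivative_powr)
    moreover have "- \<eta> - 1 = - 1 - \<eta>"
      by simp
    then have "- (M / \<eta>) * (- \<eta> * r powr (- \<eta> - 1)) = M * r powr (- 1 - \<eta>)"
      using assms by (simp only:) simp
    ultimately show "((\<lambda>r. - (M / \<eta>) * r powr - \<eta>) has_vector_derivative M * r powr (- 1 - \<eta>))
        (at r within {s..t})"
      by (simp add: has_real_derivative_iff_has_vector_derivative)
  qed
  then show ?thesis
    by (simp add: algebra_simps)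
qed

text \<open>What the bootstrap delivers about one path. \<open>w_growth\<close> starts at time 1,
  from where on the additive constant of the noise bound can be absorbed into the power of
  \<open>t\<close>.\<close>

locale escaping_path = drift A a \<beta> \<gamma> R L K C
  for A :: "'a::euclidean_space \<Rightarrow> 'a" and a \<beta> \<gamma> R L K C +
  fixes Y w :: "real \<Rightarrow> 'a" and \<kappa> \<delta> B :: real
  assumes \<beta>_less: "\<beta> < 1" and \<kappa>_pos: "\<kappa> > 0" and \<delta>_pos: "\<delta> > 0" and B_pos: "B > 0"
    and ai: "0 \<le> t \<Longrightarrow> (\<lambda>s. A (Y s + w s)) absolutely_integrable_on {0..t}"
    and increment: "0 \<le> u \<Longrightarrow> u \<le> v \<Longrightarrow> ((\<lambda>s. A (Y s + w s)) has_integral Y v - Y u) {u..v}"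
    and w_half: "0 \<le> t \<Longrightarrow> norm (w t) \<le> norm (Y t) / 2"
    and far: "0 \<le> t \<Longrightarrow> norm (Y t) \<ge> 2 * R"
    and growth: "0 \<le> t \<Longrightarrow> (\<kappa> * t) powr (1 / (1 - \<beta>)) \<le> norm (Y t)"
    and w_growth: "1 \<le> t \<Longrightarrow> norm (w t) \<le> B * t powr (1 / (1 - \<beta>) - \<delta>)"
begin

lemma Y_nonzero: "0 \<le> t \<Longrightarrow> Y t \<noteq> 0"
  using far[of t] R_pos by auto

lemma K_pos: "K > 0"
  using a_bounds[of "Y 0"] far[of 0] R_pos L_pos by auto

lemma chain_rule:
  assumes "0 \<le> s" "s \<le> t"
    and "\<And>y. y \<noteq> 0 \<Longrightarrow> (F has_derivative (\<lambda>h. G y \<bullet> h)) (at y)"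
    and "continuous_on (- {0}) G"
  shows "((\<lambda>r. G (Y r) \<bullet> A (Y r + w r)) has_integral F (Y t) - F (Y s)) {s..t}"
proof (rule has_integral_chain_rule[OF assms(2), where S = "- {0}"])
  show "(\<lambda>r. A (Y r + w r)) absolutely_integrable_on {s..t}"
    by (rule absolutely_integrable_on_subinterval[OF ai[of t]]) (use assms in auto)
qed (use assms Y_nonzero increment in auto)

lemma powr_Y_le:
  assumes "t > 0" "e \<le> 0"
  shows "norm (Y t) powr e \<le> (\<kappa> * t) powr (e / (1 - \<beta>))"
proof -
  have "norm (Y t) powr e \<le> ((\<kappa> * t) powr (1 / (1 - \<beta>))) powr e"
    using assms \<kappa>_pos growth[of t] by (intro powr_mono2') auto
  then show ?thesis
    by (simp add: powr_powr)
qed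

text \<open>Insert |Y| >= (\<kappa> t)^p with p = 1/(1-\<beta>), so that (\<beta>-1) p = -1. The
  noise term |Y|^(\<beta>-2) |w| becomes t^(-1-\<delta>), the tangential term
  |Y|^(\<beta>-\<gamma>-1) becomes t^(-1-\<gamma> p), up to constants; \<open>\<eta>\<close> is the
  smaller of the two gains.\<close>

lemma angular_speed:
  obtains M \<eta> where "M > 0" "\<eta> > 0"
    "\<And>t. 1 \<le> t \<Longrightarrow> norm (A (Y t + w t) - (A (Y t + w t) \<bullet> sgn (Y t)) *\<^sub>R sgn (Y t)) / norm (Y t)
        \<le> M * t powr (- 1 - \<eta>)"
proof -
  define p where "p = 1 / (1 - \<beta>)"
  define K' where "K' = K * 2 powr \<bar>\<beta> - 1\<bar> * B * \<kappa> powr ((\<beta> - 2) * p)"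
  define C' where "C' = C * 2 powr \<bar>\<beta> - \<gamma>\<bar> * \<kappa> powr ((\<beta> - \<gamma> - 1) * p)"
  define \<eta> where "\<eta> = min \<delta> (\<gamma> * p)"
  have p: "p > 0" "(\<beta> - 1) * p = - 1"
    using \<beta>_less by (auto simp: p_def field_simps)
  have pos: "K' > 0" "C' > 0" "\<eta> > 0"
    using K_pos C_pos B_pos \<kappa>_pos \<delta>_pos \<gamma>_pos p by (auto simp: K'_def C'_def \<eta>_def)
  have "norm (A (Y t + w t) - (A (Y t + w t) \<bullet> sgn (Y t)) *\<^sub>R sgn (Y t)) / norm (Y t)
      \<le> (K' + C') * t powr (- 1 - \<eta>)" if "1 \<le> t" for t
  proof -
    let ?n = "norm (Y t)"
    have n: "?n > 0"
      using Y_nonzero that by simp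
    have "?n powr (\<beta> - 1) / ?n * norm (w t) = ?n powr (\<beta> - 2) * norm (w t)"
      using n by (simp add: powr_diff powr_numeral power2_eq_square)
    also have "\<dots> \<le> (\<kappa> * t) powr ((\<beta> - 2) * p) * (B * t powr (p - \<delta>))"
      using powr_Y_le[of t "\<beta> - 2"] w_growth[OF that] that \<beta>_less
      by (intro mult_mono) (auto simp: p_def)
    also have "\<dots> = \<kappa> powr ((\<beta> - 2) * p) * B * t powr ((\<beta> - 2) * p + (p - \<delta>))"
      using that \<kappa>_pos by (simp add: powr_mult powr_add)
    also have "(\<beta> - 2) * p + (p - \<delta>) = - 1 - \<delta>"
      using p(2) by (simp add: algebra_simps)
    finally have 1: "?n powr (\<beta> - 1) / ?n * norm (w t) \<le> \<kappa> powr ((\<beta> - 2) * p) * B * t powr (- 1 - \<delta>)" .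
    have "?n powr (\<beta> - \<gamma>) / ?n = ?n powr (\<beta> - \<gamma> - 1)"
      using n by (simp add: powr_diff)
    also have "\<dots> \<le> (\<kappa> * t) powr ((\<beta> - \<gamma> - 1) * p)"
      using powr_Y_le[of t "\<beta> - \<gamma> - 1"] that \<beta>_less \<gamma>_pos by (simp add: p_def)
    also have "\<dots> = \<kappa> powr ((\<beta> - \<gamma> - 1) * p) * t powr ((\<beta> - \<gamma> - 1) * p)"
      using that \<kappa>_pos by (simp add: powr_mult)
    also have "t powr ((\<beta> - \<gamma> - 1) * p) = t powr (- 1 - \<gamma> * p)"
      using p(2) by (intro arg_cong[where f = "(powr) t"]) (simp add: algebra_simps)
    finally have 2: "?n powr (\<beta> - \<gamma>) / ?n
        \<le> \<kappa> powr ((\<beta> - \<gamma> - 1) * p) * t powr (- 1 - \<gamma> * p)" .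
    have mono: "t powr (- 1 - \<delta>) \<le> t powr (- 1 - \<eta>)" "t powr (- 1 - \<gamma> * p) \<le> t powr (- 1 - \<eta>)"
      using that by (auto intro!: powr_mono simp: \<eta>_def)
    have "norm (A (Y t + w t) - (A (Y t + w t) \<bullet> sgn (Y t)) *\<^sub>R sgn (Y t)) / ?n
        \<le> (K * 2 powr \<bar>\<beta> - 1\<bar> * ?n powr (\<beta> - 1) * norm (w t)
          + C * 2 powr \<bar>\<beta> - \<gamma>\<bar> * ?n powr (\<beta> - \<gamma>)) / ?n"
      using angular_drift_bound[OF far w_half] that by (intro divide_right_mono) auto
    also have "\<dots> = K * 2 powr \<bar>\<beta> - 1\<bar> * (?n powr (\<beta> - 1) / ?n * norm (w t))
        + C * 2 powr \<bar>\<beta> - \<gamma>\<bar> * (?n powr (\<beta> - \<gamma>) / ?n)"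
      by (simp add: add_divide_distrib)
    also have "\<dots> \<le> K * 2 powr \<bar>\<beta> - 1\<bar> * (\<kappa> powr ((\<beta> - 2) * p) * B * t powr (- 1 - \<delta>))
        + C * 2 powr \<bar>\<beta> - \<gamma>\<bar> * (\<kappa> powr ((\<beta> - \<gamma> - 1) * p) * t powr (- 1 - \<gamma> * p))"
      using K_pos C_pos by (intro add_mono mult_left_mono 1 2) auto
    also have "\<dots> = K' * t powr (- 1 - \<delta>) + C' * t powr (- 1 - \<gamma> * p)"
      by (simp add: K'_def C'_def mult_ac)
    also have "\<dots> \<le> K' * t powr (- 1 - \<eta>) + C' * t powr (- 1 - \<eta>)"
      using pos mono by (intro add_mono mult_left_mono) auto
    finally show ?thesis
      by (simp add: distrib_right)
  qed
  then show ?thesis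
    using that[of "K' + C'" \<eta>] pos by simp
qed

text \<open>Testing against the unit vector along the increment of \<open>sgn \<circ> Y\<close> reduces the
  vector-valued estimate to the scalar chain rule.\<close>

lemma direction_convergent:
  obtains \<phi> where "((\<lambda>t. sgn (Y t)) \<longlongrightarrow> \<phi>) at_top" "norm \<phi> = 1"
proof -
  obtain M \<eta> where M: "M > 0" "\<eta> > 0" and speed:
    "\<And>t. 1 \<le> t \<Longrightarrow> norm (A (Y t + w t) - (A (Y t + w t) \<bullet> sgn (Y t)) *\<^sub>R sgn (Y t)) / norm (Y t)
        \<le> M * t powr (- 1 - \<eta>)"
    by (rule angular_speed) (rule that)
  have bound: "norm (sgn (Y t) - sgn (Y s)) \<le> M / \<eta> * s powr - \<eta>" if st: "1 \<le> s" "s \<le> t" for s t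
  proof -
    define u where "u = sgn (sgn (Y t) - sgn (Y s))"
    have u: "norm u \<le> 1"
      by (simp add: u_def norm_sgn)
    define k where "k r = ((u - (u \<bullet> sgn (Y r)) *\<^sub>R sgn (Y r)) /\<^sub>R norm (Y r)) \<bullet> A (Y r + w r)" for r
    have k: "(k has_integral u \<bullet> sgn (Y t) - u \<bullet> sgn (Y s)) {s..t}"
      unfolding k_def
    proof (rule chain_rule[where F = "\<lambda>y. u \<bullet> sgn y"
          and G = "\<lambda>y. (u - (u \<bullet> sgn y) *\<^sub>R sgn y) /\<^sub>R norm y"])
      show "((\<lambda>y. u \<bullet> sgn y) has_derivative
          (\<lambda>h. ((u - (u \<bullet> sgn y) *\<^sub>R sgn y) /\<^sub>R norm y) \<bullet> h)) (at y)" if "y \<noteq> 0" for y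
        using that by (rule has_derivative_inner_sgn)
      show "continuous_on (- {0}) (\<lambda>y::'a. (u - (u \<bullet> sgn y) *\<^sub>R sgn y) /\<^sub>R norm y)"
        by (intro continuous_intros) auto
    qed (use st in auto)
    have k_le: "k r \<le> M * r powr (- 1 - \<eta>)" if "r \<in> {s..t}" for r
    proof -
      let ?v = "A (Y r + w r) - (A (Y r + w r) \<bullet> sgn (Y r)) *\<^sub>R sgn (Y r)"
      \<comment> \<open>The orthogonal projection is self-adjoint, so it moves from \<open>u\<close>
        to the drift, where \<open>speed\<close> bounds it.\<close>
      have "k r = (u \<bullet> ?v) / norm (Y r)"
        by (simp add: k_def inner_diff_left inner_diff_right inner_commute[of "sgn (Y r)"]
            divide_inverse mult.commute)
      also have "\<dots> \<le> norm ?v / norm (Y r)"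
        using norm_cauchy_schwarz[of u ?v] mult_right_mono[OF u norm_ge_zero[of ?v]]
        by (intro divide_right_mono) auto
      also have "\<dots> \<le> M * r powr (- 1 - \<eta>)"
        by (rule speed) (use that st in simp)
      finally show ?thesis .
    qed
    have "((\<lambda>r. M * r powr (- 1 - \<eta>)) has_integral M / \<eta> * (s powr - \<eta> - t powr - \<eta>)) {s..t}"
      using has_integral_powr_neg M st by simp
    then have "u \<bullet> sgn (Y t) - u \<bullet> sgn (Y s) \<le> M / \<eta> * (s powr - \<eta> - t powr - \<eta>)"
      by (rule has_integral_le[OF k _ k_le])
    moreover have "sgn v \<bullet> v = norm v" for v :: 'a
      by (cases "v = 0") (simp_all add: sgn_div_norm dot_square_norm power2_eq_square)
    then have "u \<bullet> sgn (Y t) - u \<bullet> sgn (Y s) = norm (sgn (Y t) - sgn (Y s))"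
      unfolding u_def inner_diff_right[symmetric] .
    moreover have "M / \<eta> * (s powr - \<eta> - t powr - \<eta>) \<le> M / \<eta> * s powr - \<eta>"
      using M by (intro mult_left_mono) auto
    ultimately show ?thesis
      by linarith
  qed
  have "((\<lambda>s. M / \<eta> * s powr - \<eta>) \<longlongrightarrow> M / \<eta> * 0) at_top"
    using M by (intro tendsto_intros tendsto_neg_powr filterlim_ident) auto
  then have "((\<lambda>s. M / \<eta> * s powr - \<eta>) \<longlongrightarrow> 0) at_top"
    by simp
  from this bound obtain \<phi> where \<phi>: "((\<lambda>t. sgn (Y t)) \<longlongrightarrow> \<phi>) at_top"
    by (rule convergent_at_top_of_increment_bound)
  have "\<forall>\<^sub>F t in at_top. norm (sgn (Y t)) = 1"
    using eventually_ge_at_top[of 0] by eventually_elim (simp add: norm_sgn Y_nonzero)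
  then have "((\<lambda>t. norm (sgn (Y t))) \<longlongrightarrow> 1) at_top"
    by (rule tendsto_eventually)
  then have "norm \<phi> = 1"
    using tendsto_unique[OF _ tendsto_norm[OF \<phi>]] by simp
  then show ?thesis
    using that \<phi> by blast
qed

lemma norm_Y_at_top: "filterlim (\<lambda>t. norm (Y t)) at_top at_top"
proof (rule filterlim_at_top_mono)
  have "filterlim (\<lambda>t. \<kappa> * t) at_top at_top"
    using \<kappa>_pos by real_asymp
  moreover have "filterlim (\<lambda>r::real. r powr (1 / (1 - \<beta>))) at_top at_top"
    using \<beta>_less by real_asymp
  ultimately show "filterlim (\<lambda>t. (\<kappa> * t) powr (1 / (1 - \<beta>))) at_top at_top"
    by (rule filterlim_compose[rotated])
  show "\<forall>\<^sub>F t in at_top. (\<kappa> * t) powr (1 / (1 - \<beta>)) \<le> norm (Y t)"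
    using eventually_ge_at_top[of 0] by eventually_elim (rule growth)
qed

lemma relative_noise_tendsto: "((\<lambda>t. w t /\<^sub>R norm (Y t)) \<longlongrightarrow> 0) at_top"
proof (rule Lim_null_comparison)
  let ?p = "1 / (1 - \<beta>)"
  have "((\<lambda>t. B * \<kappa> powr - ?p * t powr - \<delta>) \<longlongrightarrow> B * \<kappa> powr - ?p * 0) at_top"
    using \<delta>_pos by (intro tendsto_intros tendsto_neg_powr filterlim_ident) auto
  then show "((\<lambda>t. B * \<kappa> powr - ?p * t powr - \<delta>) \<longlongrightarrow> 0) at_top"
    by simp
  show "\<forall>\<^sub>F t in at_top. norm (w t /\<^sub>R norm (Y t)) \<le> B * \<kappa> powr - ?p * t powr - \<delta>"
    using eventually_ge_at_top[of 1]
  proof eventually_elim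
    case (elim t)
    have "norm (w t /\<^sub>R norm (Y t)) = norm (Y t) powr - 1 * norm (w t)"
      using Y_nonzero[of t] elim by (simp add: powr_minus)
    also have "\<dots> \<le> (\<kappa> * t) powr (- 1 / (1 - \<beta>)) * (B * t powr (?p - \<delta>))"
      using powr_Y_le[of t "- 1"] w_growth[OF elim] elim by (intro mult_mono) auto
    also have "\<dots> = B * \<kappa> powr - ?p * (t powr - ?p * t powr (?p - \<delta>))"
      using elim \<kappa>_pos by (simp add: powr_mult)
    also have "t powr - ?p * t powr (?p - \<delta>) = t powr - \<delta>"
      using elim by (simp flip: powr_add)
    finally show ?case .
  qed
qed

end

section \<open>Asymptotics\<close>

context escaping_path
begin

lemma position_rescaled_tendsto:
  assumes "((\<lambda>t. sgn (Y t)) \<longlongrightarrow> \<phi>) at_top"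
  shows "((\<lambda>t. (Y t + w t) /\<^sub>R norm (Y t)) \<longlongrightarrow> \<phi>) at_top"
  using tendsto_add[OF assms relative_noise_tendsto] by (simp add: sgn_div_norm scaleR_add_right)

lemma norm_ratio_tendsto:
  assumes "((\<lambda>t. sgn (Y t)) \<longlongrightarrow> \<phi>) at_top" "norm \<phi> = 1"
  shows "((\<lambda>t. norm (Y t + w t) / norm (Y t)) \<longlongrightarrow> 1) at_top"
  using tendsto_norm[OF position_rescaled_tendsto[OF assms(1)]] assms(2)
  by (simp add: divide_inverse mult.commute)

lemma sgn_position_tendsto:
  assumes "((\<lambda>t. sgn (Y t)) \<longlongrightarrow> \<phi>) at_top" "norm \<phi> = 1"
  shows "((\<lambda>t. sgn (Y t + w t)) \<longlongrightarrow> \<phi>) at_top"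
proof (rule Lim_transform_eventually)
  have "sgn \<phi> = \<phi>" "\<phi> \<noteq> 0"
    using assms(2) by (auto simp: sgn_div_norm)
  then show "((\<lambda>t. sgn ((Y t + w t) /\<^sub>R norm (Y t))) \<longlongrightarrow> \<phi>) at_top"
    using tendsto_sgn[OF position_rescaled_tendsto[OF assms(1)]] by simp
  show "\<forall>\<^sub>F t in at_top. sgn ((Y t + w t) /\<^sub>R norm (Y t)) = sgn (Y t + w t)"
    using eventually_ge_at_top[of 0] by eventually_elim (simp add: sgn_scaleR Y_nonzero)
qed

lemma norm_position_ge: "0 \<le> t \<Longrightarrow> norm (Y t + w t) \<ge> 1 / 2 * norm (Y t)"
  using norm_diff_ineq[of "Y t" "w t"] w_half[of t] by linarith

lemma norm_position_at_top: "filterlim (\<lambda>t. norm (Y t + w t)) at_top at_top"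
proof (rule filterlim_at_top_mono)
  show "filterlim (\<lambda>t. 1 / 2 * norm (Y t)) at_top at_top"
    by (rule filterlim_tendsto_pos_mult_at_top[OF tendsto_const _ norm_Y_at_top]) simp
  show "\<forall>\<^sub>F t in at_top. 1 / 2 * norm (Y t) \<le> norm (Y t + w t)"
    using eventually_ge_at_top[of 0] by eventually_elim (rule norm_position_ge)
qed

text \<open>After normalisation the radial drift is \<open>a (Z t)\<close> times two factors tending
  to 1, the power of the norm ratio and the cosine of the angle between \<open>Y t\<close> and
  \<open>Z t\<close>. The tangential drift carries an extra |Z|^(-\<gamma>) and vanishes in the
  limit.\<close>

lemma radial_speed_tendsto:
  assumes \<phi>: "((\<lambda>t. sgn (Y t)) \<longlongrightarrow> \<phi>) at_top" "norm \<phi> = 1"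
    and A: "radial_growth \<beta> a abar A"
  shows "((\<lambda>t. norm (Y t) powr (- 1 - \<beta>) * (Y t \<bullet> A (Y t + w t))) \<longlongrightarrow> abar \<phi>) at_top"
proof -
  define Z where "Z t = Y t + w t" for t
  define \<rho> where "\<rho> t = norm (Z t) / norm (Y t)" for t
  have \<rho>: "(\<rho> \<longlongrightarrow> 1) at_top"
    unfolding \<rho>_def Z_def by (rule norm_ratio_tendsto[OF \<phi>])
  have \<rho>_eq: "\<rho> t powr \<beta> = norm (Y t) powr - \<beta> * norm (Z t) powr \<beta>" for t
    by (simp add: \<rho>_def powr_divide powr_minus field_simps)
  from \<rho> have \<rho>_powr: "((\<lambda>t. \<rho> t powr \<beta>) \<longlongrightarrow> 1) at_top"
    using tendsto_powr[OF \<rho> tendsto_const[of \<beta>]] by simp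
  have Z_top: "filterlim (\<lambda>t. norm (Z t)) at_top at_top"
    unfolding Z_def by (rule norm_position_at_top)
  have sgnZ: "((\<lambda>t. sgn (Z t)) \<longlongrightarrow> \<phi>) at_top"
    unfolding Z_def by (rule sgn_position_tendsto[OF \<phi>])
  \<comment> \<open>Escape to infinity and convergence of the direction combine to the joint limit
    under which \<open>abar\<close> is defined.\<close>
  have "filterlim Z (inf at_infinity (filtercomap sgn (nhds \<phi>))) at_top"
    unfolding filterlim_inf filterlim_filtercomap_iff
    using sgnZ Z_top by (simp add: o_def filterlim_norm_at_top_imp_at_infinity)
  moreover have "(a \<longlongrightarrow> abar \<phi>) (inf at_infinity (filtercomap sgn (nhds \<phi>)))"
    using A \<phi>(2) by (simp add: radial_growth_def)
  ultimately have aZ: "((\<lambda>t. a (Z t)) \<longlongrightarrow> abar \<phi>) at_top"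
    by (rule filterlim_compose[rotated])
  have "((\<lambda>t. sgn (Y t) \<bullet> sgn (Z t)) \<longlongrightarrow> \<phi> \<bullet> \<phi>) at_top"
    by (intro tendsto_inner \<phi>(1) sgnZ)
  then have main: "((\<lambda>t. a (Z t) * \<rho> t powr \<beta> * (sgn (Y t) \<bullet> sgn (Z t))) \<longlongrightarrow> abar \<phi> * 1 * 1) at_top"
    using \<phi>(2) by (intro tendsto_mult aZ \<rho>_powr) (simp add: dot_square_norm)
  have err: "((\<lambda>t. norm (Y t) powr - \<beta> * (sgn (Y t) \<bullet> tangential_part A (Z t))) \<longlongrightarrow> 0) at_top"
  proof (rule Lim_null_comparison)
    have "((\<lambda>t. C * \<rho> t powr \<beta> * norm (Z t) powr - \<gamma>) \<longlongrightarrow> C * 1 * 0) at_top"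
      using \<gamma>_pos by (intro tendsto_mult tendsto_const \<rho>_powr tendsto_neg_powr Z_top) auto
    then show "((\<lambda>t. C * \<rho> t powr \<beta> * norm (Z t) powr - \<gamma>) \<longlongrightarrow> 0) at_top"
      by simp
    show "\<forall>\<^sub>F t in at_top. norm (norm (Y t) powr - \<beta> * (sgn (Y t) \<bullet> tangential_part A (Z t)))
        \<le> C * \<rho> t powr \<beta> * norm (Z t) powr - \<gamma>"
      using eventually_ge_at_top[of 0]
    proof eventually_elim
      case (elim t)
      have Z: "norm (Z t) \<ge> R" "norm (Y t) > 0"
        using norm_position_ge[OF elim] far[OF elim] Y_nonzero[OF elim] by (auto simp: Z_def)
      have "\<bar>sgn (Y t) \<bullet> tangential_part A (Z t)\<bar> \<le> 1 * norm (tangential_part A (Z t))"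
        using Cauchy_Schwarz_ineq2[of "sgn (Y t)"] Z(2) by (simp add: norm_sgn)
      also have "\<dots> \<le> C * norm (Z t) powr (\<beta> - \<gamma>)"
        using tangential[OF Z(1)] by simp
      finally have "norm (Y t) powr - \<beta> * \<bar>sgn (Y t) \<bullet> tangential_part A (Z t)\<bar>
          \<le> norm (Y t) powr - \<beta> * (C * norm (Z t) powr (\<beta> - \<gamma>))"
        by (intro mult_left_mono) auto
      also have "\<dots> = C * \<rho> t powr \<beta> * norm (Z t) powr - \<gamma>"
        by (simp add: \<rho>_eq powr_diff powr_minus divide_inverse)
      finally show ?case
        by (simp add: abs_mult)
    qed
  qed
  have "\<forall>\<^sub>F t in at_top. a (Z t) * \<rho> t powr \<beta> * (sgn (Y t) \<bullet> sgn (Z t))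
      + norm (Y t) powr - \<beta> * (sgn (Y t) \<bullet> tangential_part A (Z t))
      = norm (Y t) powr (- 1 - \<beta>) * (Y t \<bullet> A (Y t + w t))"
    using eventually_ge_at_top[of 0]
  proof eventually_elim
    case (elim t)
    have pos: "norm (Y t) > 0" "Z t \<noteq> 0"
      using norm_position_ge[OF elim] Y_nonzero[OF elim] by (auto simp: Z_def)
    have "sgn (Y t) \<bullet> A (Z t)
        = a (Z t) * norm (Z t) powr \<beta> * (sgn (Y t) \<bullet> sgn (Z t)) + sgn (Y t) \<bullet> tangential_part A (Z t)"
      by (subst decomposition[OF pos(2)]) (simp add: inner_add_right)
    moreover have "norm (Y t) powr (- 1 - \<beta>) * (Y t \<bullet> A (Z t))
        = norm (Y t) powr - \<beta> * (sgn (Y t) \<bullet> A (Z t))"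
      using pos by (simp add: sgn_div_norm powr_diff powr_minus divide_inverse)
    ultimately show ?case
      by (simp add: \<rho>_eq Z_def distrib_left mult_ac)
  qed
  with tendsto_add[OF main err] show ?thesis
    by (simp add: Lim_transform_eventually)
qed

lemma escape:
  assumes A: "radial_growth \<beta> a abar A"
  shows "power_law_escape \<beta> abar (\<lambda>t. Y t + w t)"
proof -
  obtain \<phi> where \<phi>: "((\<lambda>t. sgn (Y t)) \<longlongrightarrow> \<phi>) at_top" "norm \<phi> = 1"
    by (rule direction_convergent)
  define q where "q = 1 - \<beta>"
  define c where "c t = (q * abar \<phi> * t) powr (1 / q)" for t
  have q: "q > 0" "abar \<phi> > 0"
    using \<beta>_less A \<phi>(2) by (auto simp: q_def radial_growth_def)
  have "q - 2 = - 1 - \<beta>"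
    by (simp add: q_def)
  then have "((\<lambda>t. ((q * norm (Y t) powr (q - 2)) *\<^sub>R Y t) \<bullet> A (Y t + w t)) \<longlongrightarrow> q * abar \<phi>) at_top"
    using tendsto_mult[OF tendsto_const[of q] radial_speed_tendsto[OF \<phi> A]]
    by (simp add: mult.assoc)
  then have "((\<lambda>t. norm (Y t) powr q / t) \<longlongrightarrow> q * abar \<phi>) at_top"
  proof (rule antiderivative_over_identity_tendsto)
    fix s t :: real assume "0 \<le> s" "s \<le> t"
    then show "((\<lambda>t. ((q * norm (Y t) powr (q - 2)) *\<^sub>R Y t) \<bullet> A (Y t + w t)) has_integral
        norm (Y t) powr q - norm (Y s) powr q) {s..t}"
    proof (rule chain_rule[where F = "\<lambda>y. norm y powr q" and G = "\<lambda>y. (q * norm y powr (q - 2)) *\<^sub>R y"])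
      show "continuous_on (- {0}) (\<lambda>y::'a. (q * norm y powr (q - 2)) *\<^sub>R y)"
        by (intro continuous_intros) auto
    qed (rule has_derivative_norm_powr)
  qed
  then have "((\<lambda>t. (norm (Y t) powr q / t / (q * abar \<phi>)) powr (1 / q)) \<longlongrightarrow>
      (q * abar \<phi> / (q * abar \<phi>)) powr (1 / q)) at_top"
    using q by (intro tendsto_powr tendsto_divide tendsto_const) auto
  then have "((\<lambda>t. (norm (Y t) powr q / t / (q * abar \<phi>)) powr (1 / q)) \<longlongrightarrow> 1) at_top"
    using q by simp
  moreover have "\<forall>\<^sub>F t in at_top. (norm (Y t) powr q / t / (q * abar \<phi>)) powr (1 / q) = norm (Y t) / c t"
    using eventually_gt_at_top[of 0]
    by eventually_elim (use q in \<open>simp add: c_def powr_divide powr_mult powr_powr mult_ac\<close>)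
  ultimately have "((\<lambda>t. norm (Y t) / c t) \<longlongrightarrow> 1) at_top"
    by (rule Lim_transform_eventually)
  \<comment> \<open>The size of \<open>Y\<close> relative to \<open>c\<close> and the position
    relative to the size of \<open>Y\<close> multiply to the position relative to \<open>c\<close>.
    As |\<phi>| = 1, its convergence to \<open>\<phi>\<close> is the claimed equivalence.\<close>
  from tendsto_scaleR[OF this position_rescaled_tendsto[OF \<phi>(1)]]
  have "((\<lambda>t. (norm (Y t) / c t) *\<^sub>R ((Y t + w t) /\<^sub>R norm (Y t))) \<longlongrightarrow> \<phi>) at_top"
    by simp
  moreover have "\<forall>\<^sub>F t in at_top. (norm (Y t) / c t) *\<^sub>R ((Y t + w t) /\<^sub>R norm (Y t)) = (Y t + w t) /\<^sub>R c t"
    using eventually_ge_at_top[of 0]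
    by eventually_elim (simp add: Y_nonzero divide_inverse)
  ultimately have "((\<lambda>t. (Y t + w t) /\<^sub>R c t) \<longlongrightarrow> \<phi>) at_top"
    by (rule Lim_transform_eventually)
  then have lim: "((\<lambda>t. norm ((Y t + w t) /\<^sub>R c t - \<phi>)) \<longlongrightarrow> 0) at_top"
    by (intro tendsto_norm_zero LIM_zero)
  have c_pos: "\<forall>\<^sub>F t in at_top. c t > 0"
    using eventually_gt_at_top[of 0] by eventually_elim (use q in \<open>simp add: c_def\<close>)
  have "\<forall>\<^sub>F t in at_top. norm ((Y t + w t) /\<^sub>R c t - \<phi>)
      = norm (Y t + w t - c t *\<^sub>R \<phi>) / norm (c t *\<^sub>R \<phi>)"
    using c_pos
  proof eventually_elim
    case (elim t)
    then have "(Y t + w t) /\<^sub>R c t - \<phi> = (Y t + w t - c t *\<^sub>R \<phi>) /\<^sub>R c t"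
      by (simp add: scaleR_diff_right)
    with elim \<phi>(2) show ?case
      by (simp add: divide_inverse mult.commute)
  qed
  with lim have "((\<lambda>t. norm (Y t + w t - c t *\<^sub>R \<phi>) / norm (c t *\<^sub>R \<phi>)) \<longlongrightarrow> 0) at_top"
    by (rule Lim_transform_eventually)
  moreover have "\<forall>\<^sub>F t in at_top. norm (c t *\<^sub>R \<phi>) \<noteq> 0"
    using c_pos by eventually_elim (use \<phi>(2) in auto)
  ultimately have "vec_asymp (\<lambda>t. Y t + w t) (\<lambda>t. c t *\<^sub>R \<phi>)"
    unfolding vec_asymp_def by (intro smalloI_tendsto)
  then show ?thesis
    unfolding power_law_escape_def
    using norm_position_at_top sgn_position_tendsto[OF \<phi>] by (auto simp: c_def q_def)
qed

end

section \<open>The threshold radius\<close>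

lemma drift_locale:
  fixes A :: "'a::euclidean_space \<Rightarrow> 'a"
  assumes "radial_growth \<beta> a abar A" "tangential_bound \<beta> A"
  obtains \<gamma> R L K C where "drift A a \<beta> \<gamma> R L K C"
proof -
  obtain R1 L K where "R1 > 0" "L > 0" and a: "\<And>z. norm z \<ge> R1 \<Longrightarrow> L \<le> a z \<and> a z \<le> K"
    using radial_coefficient_bounds[OF assms(1)] by metis
  obtain \<gamma> C R2 where "\<gamma> > 0" "C > 0" "R2 > 0"
    and tan: "\<forall>r>R2. \<forall>y\<in>sphere 0 r. norm (tangential_part A y) \<le> C * r powr (\<beta> - \<gamma>)"
    using assms(2) unfolding tangential_bound_def by blast
  \<comment> \<open>The tangential bound holds strictly beyond \<open>R2\<close>, whereas the locale
    includes its threshold; hence the \<open>+ 1\<close>.\<close>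
  have "drift A a \<beta> \<gamma> (max R1 (R2 + 1)) L K C"
  proof
    fix z :: 'a assume "max R1 (R2 + 1) \<le> norm z"
    then show "L \<le> a z \<and> a z \<le> K" "norm (tangential_part A z) \<le> C * norm z powr (\<beta> - \<gamma>)"
      using a[of z] tan by auto
  qed (use assms(1) \<open>\<gamma> > 0\<close> \<open>C > 0\<close> \<open>L > 0\<close> \<open>R1 > 0\<close> in \<open>auto simp: radial_growth_def\<close>)
  then show ?thesis
    by (rule that)
qed

text \<open>\<open>R0\<close> is fixed before the noise, the starting point and the solution.
  \<open>B\<close> and \<open>\<delta>\<close> remain free, so that a noise with too large a
  \<open>\<delta>\<close> can later be treated as a bounded one.\<close>

lemma escape_radius:
  fixes A :: "'a::euclidean_space \<Rightarrow> 'a"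
  assumes \<beta>: "\<beta> < 1"
    and A: "radial_growth \<beta> a abar A" "tangential_bound \<beta> A"
    and \<delta>: "0 < \<delta>" "\<delta> \<le> 1 / (1 - \<beta>)"
    and "B > 0"
  obtains R0 where "R0 > 0"
    "\<And>\<xi> x Z. (\<And>t. 0 \<le> t \<Longrightarrow> norm (\<xi> t) \<le> B * (1 + t powr (1 / (1 - \<beta>) - \<delta>))) \<Longrightarrow> \<xi> 0 = 0 \<Longrightarrow>
       norm x \<ge> R0 \<Longrightarrow> is_solution A \<xi> x Z \<Longrightarrow> power_law_escape \<beta> abar Z"
proof -
  define q where "q = 1 - \<beta>"
  have q: "q > 0" "q - 2 = - 1 - \<beta>" "1 / q > 0"
    using \<beta> by (auto simp: q_def)
  obtain \<gamma> R L K C where "drift A a \<beta> \<gamma> R L K C"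
    using drift_locale[OF A] .
  then interpret drift A a \<beta> \<gamma> R L K C .
  obtain R' \<kappa> where R': "R' \<ge> 2 * R" and "\<kappa> > 0"
    and out: "\<And>y w. norm y \<ge> R' \<Longrightarrow> norm w \<le> norm y / 2 \<Longrightarrow>
      \<kappa> \<le> norm y powr (- 1 - \<beta>) * (y \<bullet> A (y + w))"
    by (rule outward_drift) (rule that)
  \<comment> \<open>Half of the rate \<open>q * \<kappa>\<close> at which |Y|^q grows, matching the
    factor 1/2 in the bootstrap curve.\<close>
  define \<kappa>' where "\<kappa>' = q * \<kappa> / 2"
  have "\<kappa>' > 0" "R' > 0"
    using q \<open>\<kappa> > 0\<close> R' R_pos by (auto simp: \<kappa>'_def)
  obtain M where "M > 0" and M: "\<And>m t. m \<ge> M \<Longrightarrow> t \<ge> 0 \<Longrightarrow>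
      B * (1 + t powr (1 / q - \<delta>)) \<le> (m + \<kappa>' * t) powr (1 / q) / 2"
    using sublinear_noise_dominated[of "1 / q" \<delta> \<kappa>' B] q \<delta> \<open>B > 0\<close> \<open>\<kappa>' > 0\<close>
    unfolding q_def by metis
  \<comment> \<open>This makes m = |x|^q / 2 at least \<open>M\<close>, so that the curve dominates
    the noise, and at least \<open>R' powr q\<close>, so that it starts beyond
    \<open>R'\<close>.\<close>
  define R0 where "R0 = (2 * max M (R' powr q)) powr (1 / q)"
  have "R0 > 0"
    using \<open>M > 0\<close> by (simp add: R0_def)
  moreover have "power_law_escape \<beta> abar Z"
    if noise: "\<And>t. 0 \<le> t \<Longrightarrow> norm (\<xi> t) \<le> B * (1 + t powr (1 / (1 - \<beta>) - \<delta>))" and "\<xi> 0 = 0"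
      and x: "norm x \<ge> R0" and sol: "is_solution A \<xi> x Z" for \<xi> x Z
  proof -
    define Y where "Y t = Z t - \<xi> t" for t
    have Z: "Z t = Y t + \<xi> t" for t
      by (simp add: Y_def)
    note ai = is_solution_absolutely_integrable[OF sol, unfolded Z]
    have inc: "((\<lambda>s. A (Y s + \<xi> s)) has_integral Y v - Y u) {u..v}" if "0 \<le> u" "u \<le> v" for u v
      using is_solution_increment[OF sol that] by (simp add: Z)
    have "Z 0 = x"
      using sol \<open>\<xi> 0 = 0\<close> unfolding is_solution_def
      by (auto dest!: spec[of _ 0] simp: set_lebesgue_integral_eq_integral)
    then have "Y 0 = x"
      by (simp add: Y_def \<open>\<xi> 0 = 0\<close>)
    define m where "m = norm x powr q / 2"
    have "2 * max M (R' powr q) = R0 powr q"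
      using q \<open>M > 0\<close> by (simp add: R0_def powr_powr)
    also have "\<dots> \<le> norm x powr q"
      using x \<open>R0 > 0\<close> q by (intro powr_mono2) auto
    finally have m: "m \<ge> M" "m \<ge> R' powr q"
      by (auto simp: m_def)
    have low: "((norm (Y 0) powr q + q * \<kappa> * t) / 2) powr (1 / q) = (m + \<kappa>' * t) powr (1 / q)" for t
      by (simp add: m_def \<kappa>'_def \<open>Y 0 = x\<close> add_divide_distrib)
    have R'_low: "R' \<le> (m + \<kappa>' * t) powr (1 / q)" if "0 \<le> t" for t
    proof -
      have "R' = (R' powr q) powr (1 / q)"
        using q \<open>R' > 0\<close> by (simp add: powr_powr)
      also have "\<dots> \<le> (m + \<kappa>' * t) powr (1 / q)"
        using m(2) that q \<open>\<kappa>' > 0\<close> by (intro powr_mono2 add_increasing2) auto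
      finally show ?thesis .
    qed
    have \<xi>_low: "norm (\<xi> t) \<le> (m + \<kappa>' * t) powr (1 / q) / 2" if "0 \<le> t" for t
      using noise[OF that] M[OF m(1) that] by (simp add: q_def)
    have Y_low: "(m + \<kappa>' * t) powr (1 / q) \<le> norm (Y t)" if "0 \<le> t" for t
      unfolding low[symmetric]
    proof (rule norm_growth_bootstrap[where g = "\<lambda>s. A (Y s + \<xi> s)" and R = R' and w = \<xi>])
      fix s :: real assume "R' \<le> norm (Y s)" "norm (\<xi> s) \<le> norm (Y s) / 2"
      then show "\<kappa> \<le> norm (Y s) powr (q - 2) * (Y s \<bullet> A (Y s + \<xi> s))"
        unfolding q(2) by (rule out)
    qed (use q that \<open>\<kappa> > 0\<close> \<open>R' > 0\<close> ai inc R'_low[of 0] \<xi>_low in \<open>auto simp only: low order_refl\<close>)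
    interpret escaping_path A a \<beta> \<gamma> R L K C Y \<xi> \<kappa>' \<delta> "2 * B"
    proof
      fix t :: real
      show "norm (\<xi> t) \<le> norm (Y t) / 2" if "0 \<le> t"
        using \<xi>_low[OF that] Y_low[OF that] by simp
      show "2 * R \<le> norm (Y t)" if "0 \<le> t"
        using R'_low[OF that] Y_low[OF that] R' by simp
      show "(\<kappa>' * t) powr (1 / (1 - \<beta>)) \<le> norm (Y t)" if "0 \<le> t"
      proof -
        have "(\<kappa>' * t) powr (1 / q) \<le> (m + \<kappa>' * t) powr (1 / q)"
          using that q m \<open>M > 0\<close> \<open>\<kappa>' > 0\<close> by (intro powr_mono2) auto
        then show ?thesis
          using Y_low[OF that] by (simp add: q_def)
      qed
      show "norm (\<xi> t) \<le> 2 * B * t powr (1 / (1 - \<beta>) - \<delta>)" if "1 \<le> t"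
      proof -
        have "1 \<le> t powr (1 / (1 - \<beta>) - \<delta>)"
          using that \<delta> by (intro ge_one_powr_ge_zero) auto
        then have "B * (1 + t powr (1 / (1 - \<beta>) - \<delta>)) \<le> B * (2 * t powr (1 / (1 - \<beta>) - \<delta>))"
          using \<open>B > 0\<close> by (intro mult_left_mono) auto
        then show ?thesis
          using noise[of t] that by simp
      qed
    qed (use \<beta> \<delta> \<open>B > 0\<close> \<open>\<kappa>' > 0\<close> ai inc in auto)
    show ?thesis
      using escape[OF A(1)] by (simp add: Y_def)
  qed
  ultimately show ?thesis
    using that by blast
qed

text \<open>The first clause gives one radius for all noises with the same constants. For \<delta> >
  1/(1-\<beta>) the growth bound blows up as t tends to 0, where a noise is then controlled only by
  its own local boundedness; the second clause therefore lets the radius depend on the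
  noise.\<close>

theorem theorem2p1:
  fixes A :: "real ^ 'd \<Rightarrow> real ^ 'd"
    and a abar :: "real ^ 'd \<Rightarrow> real"
    and \<beta> \<delta> C\<xi> :: real
  assumes "\<beta> < 1"
    and "radial_growth \<beta> a abar A"
    and "tangential_bound \<beta> A"
    and "\<delta> > 0"
    and "C\<xi> > 0"
  shows "(\<delta> \<le> 1 / (1 - \<beta>) \<longrightarrow>
            (\<exists>R0 > 0. \<forall>\<xi>. noise \<beta> \<delta> C\<xi> \<xi> \<longrightarrow>
               (\<forall>x Z. norm x \<ge> R0 \<longrightarrow> is_solution A \<xi> x Z \<longrightarrow> power_law_escape \<beta> abar Z)))
       \<and> (\<forall>\<xi>. noise \<beta> \<delta> C\<xi> \<xi> \<longrightarrow>
            (\<exists>R0 > 0. \<forall>x Z. norm x \<ge> R0 \<longrightarrow> is_solution A \<xi> x Z \<longrightarrow> power_law_escape \<beta> abar Z))"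
proof -
  have uniform: "\<exists>R0 > 0. \<forall>\<xi>. noise \<beta> \<delta> C\<xi> \<xi> \<longrightarrow>
      (\<forall>x Z. norm x \<ge> R0 \<longrightarrow> is_solution A \<xi> x Z \<longrightarrow> power_law_escape \<beta> abar Z)"
    if small: "\<delta> \<le> 1 / (1 - \<beta>)"
  proof -
    obtain R0 where "R0 > 0" and R0:
      "\<And>\<xi> x Z. (\<And>t. 0 \<le> t \<Longrightarrow> norm (\<xi> t) \<le> C\<xi> * (1 + t powr (1 / (1 - \<beta>) - \<delta>))) \<Longrightarrow> \<xi> 0 = 0 \<Longrightarrow>
       norm x \<ge> R0 \<Longrightarrow> is_solution A \<xi> x Z \<Longrightarrow> power_law_escape \<beta> abar Z"
      using escape_radius[OF assms(1-4) small assms(5)] by blast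
    show ?thesis
    proof (intro exI[of _ R0] conjI allI impI)
      fix \<xi> x Z
      assume "noise \<beta> \<delta> C\<xi> \<xi>" "R0 \<le> norm x" "is_solution A \<xi> x Z"
      then show "power_law_escape \<beta> abar Z"
        by (intro R0[of \<xi>]) (auto simp: noise_def)
    qed (rule \<open>R0 > 0\<close>)
  qed
  have pointwise: "\<exists>R0 > 0. \<forall>x Z. norm x \<ge> R0 \<longrightarrow> is_solution A \<xi> x Z \<longrightarrow> power_law_escape \<beta> abar Z"
    if \<xi>: "noise \<beta> \<delta> C\<xi> \<xi>" for \<xi>
  proof (cases "\<delta> \<le> 1 / (1 - \<beta>)")
    case True
    then show ?thesis
      using uniform \<xi> by blast
  next
    text \<open>The noise is now bounded, by a constant that depends on the path.\<close>
    case False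
    have "bounded (\<xi> ` {0..1})"
      using \<xi> by (simp add: noise_def)
    then obtain B1 where B1: "\<And>t. t \<in> {0..1} \<Longrightarrow> norm (\<xi> t) \<le> B1"
      unfolding bounded_iff by blast
    \<comment> \<open>\<open>B1\<close> covers the times up to 1; afterwards the negative exponent
      keeps the power below 1, which leaves \<open>2 * C\<xi>\<close>.\<close>
    define B where "B = max B1 (2 * C\<xi>)"
    have "B > 0"
      using assms(5) by (simp add: B_def)
    have bound: "norm (\<xi> t) \<le> B * (1 + t powr e)" if "0 \<le> t" for t e
    proof -
      have "norm (\<xi> t) \<le> B"
      proof (cases "t \<le> 1")
        case True
        then show ?thesis
          using B1[of t] that by (simp add: B_def)
      next
        case 2: False
        then have "t powr (1 / (1 - \<beta>) - \<delta>) \<le> t powr 0"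
          using False by (intro powr_mono) auto
        then have "C\<xi> * (1 + t powr (1 / (1 - \<beta>) - \<delta>)) \<le> C\<xi> * 2"
          using 2 assms(5) by (intro mult_left_mono) auto
        moreover have "norm (\<xi> t) \<le> C\<xi> * (1 + t powr (1 / (1 - \<beta>) - \<delta>))"
          using \<xi> that by (simp add: noise_def)
        ultimately show ?thesis
          by (simp add: B_def)
      qed
      also have "\<dots> \<le> B * (1 + t powr e)"
        using \<open>B > 0\<close> by simp
      finally show ?thesis .
    qed
    have "1 / (1 - \<beta>) > 0"
      using assms(1) by simp
    \<comment> \<open>The borderline choice \<delta> = 1/(1-\<beta>) makes the exponent 0. Since
      \<open>0 powr 0 = 0\<close>, the bound at time 0 is just \<open>B\<close>, and
      \<open>bound\<close> covers this too.\<close>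
    then obtain R0 where "R0 > 0" and R0:
      "\<And>\<xi> x Z. (\<And>t. 0 \<le> t \<Longrightarrow> norm (\<xi> t) \<le> B * (1 + t powr (1 / (1 - \<beta>) - 1 / (1 - \<beta>)))) \<Longrightarrow> \<xi> 0 = 0 \<Longrightarrow>
       norm x \<ge> R0 \<Longrightarrow> is_solution A \<xi> x Z \<Longrightarrow> power_law_escape \<beta> abar Z"
      using escape_radius[OF assms(1-3) _ order_refl \<open>B > 0\<close>] by blast
    moreover have "\<xi> 0 = 0"
      using \<xi> by (simp add: noise_def)
    ultimately show ?thesis
      using bound by blast
  qed
  show ?thesis
    using uniform pointwise by blast
qed

end
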